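(* There exist constants $C>0$ and $r_0>0$ such that for all $r\ge r_0$, $$\left|\,p_H(r)-\frac{e^2}{4}\,r^4\right|\le C\,r^{18/5}.$$ That is, $p_H(r)=\frac{e^{2}}{4}r^{4}+O\left(r^{18/5}\right)$ as $r\to\infty$.
   Context: Let $\phi_0,\phi_1,\phi_2,\dots$ be independent standard complex Gaussian random variables, i.e. each $\phi_n$ has density $\pi^{-1}\exp(-|z|^2)$ with respect to Lebesgue measure on $\mathbb{C}$. Let $$f(z)=\sum_{n=0}^\infty \phi_n\frac{z^n}{\sqrt{n!}},$$ which is almost surely an entire function. For $r>0$ the hole probability is $P_H(r)=\mathbb{P}\left(f(z)\ne 0 \text{ for all } |z|\le r\right)$, and $p_H(r)=\log^{-}P_H(r)=-\log P_H(r)$. *)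

theory Defs
  imports "HOL-Probability.Probability"
begin

definition iid_std_complex_gaussian :: "'a measure \<Rightarrow> (nat \<Rightarrow> 'a \<Rightarrow> complex) \<Rightarrow> bool" where
  "iid_std_complex_gaussian M \<phi> \<longleftrightarrow>
     prob_space.indep_vars M (\<lambda>_. borel) \<phi> UNIV \<and>
     (\<forall>n. distributed M lborel (\<phi> n) (\<lambda>z. ennreal (exp (- (norm z)\<^sup>2) / pi)))"

definition gef :: "(nat \<Rightarrow> 'a \<Rightarrow> complex) \<Rightarrow> 'a \<Rightarrow> complex \<Rightarrow> complex" where
  "gef \<phi> \<omega> z = (\<Sum>n. \<phi> n \<omega> * z ^ n / complex_of_real (sqrt (fact n)))"

text \<open>The series converges everywhere only almost surely, and on the exceptional null set the
  hole event need not lie in \<^term>\<open>sets M\<close>. Since \<^term>\<open>measure M\<close> is 0 on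
  non-measurable sets, the probability is taken in the completion of \<^term>\<open>M\<close>,
  where the values on the exceptional set do not matter.\<close>

definition hole_prob :: "'a measure \<Rightarrow> (nat \<Rightarrow> 'a \<Rightarrow> complex) \<Rightarrow> real \<Rightarrow> real" where
  "hole_prob M \<phi> r =
     measure (completion M) {\<omega> \<in> space M. \<forall>z. norm z \<le> r \<longrightarrow> gef \<phi> \<omega> z \<noteq> 0}"

text \<open>The library convention \<^prop>\<open>ln 0 = (0::real)\<close> would give the value 0 for
  a vanishing hole probability, where the intended value is infinite. A positive lower bound on
  this quantity therefore still forces the hole probability to be positive.\<close>

definition neg_log_hole_prob :: "'a measure \<Rightarrow> (nat \<Rightarrow> 'a \<Rightarrow> complex) \<Rightarrow> real \<Rightarrow> real" where
  "neg_log_hole_prob M \<phi> r = - ln (hole_prob M \<phi> r)"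

end

theory Submission
  imports Defs "HOL-Complex_Analysis.Complex_Analysis" "HOL-Real_Asymp.Real_Asymp"
begin

text \<open>The hole probability is bounded from below by the probability that \<open>|\<phi> 0| \<ge> 3\<close> while
  each other term of the series is so small that the constant term dominates on the disc. The constraint
  on \<open>\<phi> n\<close> is effective only for \<open>n < e r^2\<close>, where it costs about
  \<open>ln (r^(2n) / n!)\<close>; summing these costs gives \<open>e^2 r^4 / 4\<close>.

  For the upper bound, if \<open>f\<close> has no zeros in the disc then \<open>ln |f|\<close> is harmonic, so its
  mean over \<open>N \<approx> e (r - 2)^2\<close> equidistant points of the circle of radius \<open>r - 2\<close>
  nearly equals \<open>ln |f 0|\<close>, which is \<open>O(ln r)\<close> outside an event of negligible
  probability. Given the coefficients of index at least \<open>N\<close>, the values of \<open>f\<close> at these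
  points have a joint density bounded by an inverse Vandermonde determinant, of size
  \<open>exp (- e^2 r^4 / 4 + O(r^3))\<close>, and a Chernoff bound for the product of the values with an
  exponent just below the critical one shows that a small mean has at most this probability up to a
  factor \<open>exp (O(r^2 ln r))\<close>.\<close>

section \<open>Stirling sums\<close>

text \<open>Both bounds lead to the sum of \<open>ln (x^n / n!)\<close>, with \<open>x = r^2\<close>
  or \<open>x = (r - 2)^2\<close>, over the indices where it is positive. This fixes the number of
  nodes near \<open>e * x\<close>: fewer or more nodes weaken the Vandermonde bound.

  Finitely many nodes are taken instead of the whole circle because their values have an explicit
  joint density. The obstacle is the discretisation error: an average over \<open>N\<close> roots of
  unity misses the Taylor coefficients of \<open>ln f\<close> of positive index divisible by
  \<open>N\<close>. Controlling them needs room outside the circle, one unit for a Cauchy estimate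
  and one for the Borel-Caratheodory inequality, whence the radius \<open>r - 2\<close>. The error
  is then governed by \<open>((r - 2) / (r - 1))^N\<close>, at most \<open>exp (- r)\<close> for
  large \<open>r\<close>.

  Shrinking the radius costs \<open>r^4 - (r - 2)^4 = O(r^3)\<close>, the largest error of the
  proof; the others are \<open>O(r^2 ln r)\<close>. All fit into \<open>r powr (18/5)\<close>, with
  constant 1 for large \<open>r\<close>.\<close>

lemma power_div_fact_le_exp:
  fixes x :: real
  assumes "x \<ge> 0"
  shows "x ^ n / fact n \<le> exp x"
proof -
  have "(\<Sum>k\<in>{n}. x ^ k / fact k) \<le> (\<Sum>k. x ^ k / fact k)"
    using assms summable_exp[of x] by (intro sum_le_suminf) (auto simp: field_simps)
  then show ?thesis by (simp add: exp_def field_simps)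
qed

lemma ln_fact_ge:
  assumes "n > 0"
  shows "real n * ln (real n) - real n \<le> ln (fact n)"
proof -
  have "ln (real n ^ n / fact n) \<le> ln (exp (real n))"
    using assms by (subst ln_le_cancel_iff) (auto intro: power_div_fact_le_exp)
  then show ?thesis using assms by (simp add: ln_div ln_realpow)
qed

lemma ln_Suc_div_bounds:
  assumes "n > 0"
  shows "1 / real (n + 1) \<le> ln (real (n + 1)) - ln (real n)" "ln (real (n + 1)) - ln (real n) \<le> 1 / real n"
proof -
  have "ln (real n / real (n + 1)) \<le> real n / real (n + 1) - 1" using assms by (intro ln_le_minus_one) auto
  then show "1 / real (n + 1) \<le> ln (real (n + 1)) - ln (real n)" using assms by (simp add: ln_div field_simps)
  have "ln (real (n + 1) / real n) \<le> real (n + 1) / real n - 1" using assms by (intro ln_le_minus_one) auto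
  then show "ln (real (n + 1)) - ln (real n) \<le> 1 / real n" using assms by (simp add: ln_div field_simps)
qed

text \<open>The surplus \<open>ln n + 1\<close> over the leading Stirling terms is crude but
  harmless: summed over \<open>O(r^2)\<close> indices it gives \<open>O(r^2 ln r)\<close>.\<close>

lemma ln_fact_le:
  assumes "n > 0"
  shows "ln (fact n) \<le> real n * ln (real n) - real n + ln (real n) + 1"
  using assms
proof (induction n rule: nat_induct_non_zero)
  case (Suc n)
  have "1 = real (n + 1) * (1 / real (n + 1))" by simp
  also have "\<dots> \<le> real (n + 1) * (ln (real (n + 1)) - ln (real n))"
    by (intro mult_left_mono ln_Suc_div_bounds) (use Suc in auto)
  finally have "1 \<le> real (n + 1) * (ln (real (n + 1)) - ln (real n))" .
  moreover have "ln (fact (Suc n)) = ln (real (n + 1)) + ln (fact n)"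
    using Suc.hyps by (simp add: ln_mult flip: of_nat_Suc)
  ultimately show ?case using Suc.IH by (simp add: algebra_simps)
qed simp

text \<open>\<open>Psi x\<close> is an antiderivative of \<open>y \<mapsto> y * ln (e * x / y)\<close>, the
  Stirling approximation of \<open>ln (x ^ y / y!)\<close>. It attains its maximum at \<open>y = e * x\<close>.\<close>

definition Psi :: "real \<Rightarrow> real \<Rightarrow> real" where
  "Psi x y = y\<^sup>2 * (3 / 4 + ln x / 2 - ln y / 2)"

text \<open>In the variable \<open>v = (y / (e * x))^2\<close> the function is
  \<open>e^2 * x^2 / 4\<close> times \<open>v * (1 - ln v)\<close>, and
  \<open>- ln v \<le> 1 / v - 1\<close> bounds the latter by its value at
  \<open>v = 1\<close>.\<close>

lemma Psi_le:
  assumes "x > 0" "y > 0"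
  shows "Psi x y \<le> (exp 1)\<^sup>2 / 4 * x\<^sup>2"
proof -
  define v where "v = (y / (exp 1 * x))\<^sup>2"
  have v: "v > 0" using assms by (simp add: v_def)
  have lnv: "ln v = 2 * (ln y - 1 - ln x)"
    using assms by (simp add: v_def ln_realpow ln_div ln_mult power2_eq_square)
  have "- ln v \<le> 1 / v - 1" using ln_le_minus_one[of "1 / v"] v by (simp add: ln_div)
  then have "v * (1 - ln v) \<le> v * (1 / v)" using v by (intro mult_left_mono) auto
  then have "v * (1 - ln v) \<le> 1" using v by simp
  then have "(exp 1)\<^sup>2 / 4 * x\<^sup>2 * (v * (1 - ln v)) \<le> (exp 1)\<^sup>2 / 4 * x\<^sup>2 * 1"
    by (intro mult_left_mono) auto
  also have "(exp 1)\<^sup>2 / 4 * x\<^sup>2 * (v * (1 - ln v)) = Psi x y"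
    unfolding lnv using assms by (simp add: v_def Psi_def power_divide power_mult_distrib field_simps)
  finally show ?thesis by simp
qed

text \<open>The maximum at \<open>e * x\<close> is quadratically flat, so rounding
  \<open>e * x\<close> down to an integer loses only a bounded amount.\<close>

lemma Psi_ge:
  assumes x: "x \<ge> 1" and y: "y > 0" "y \<le> exp 1 * x" "exp 1 * x - 1 \<le> y"
  shows "Psi x y \<ge> (exp 1)\<^sup>2 / 4 * x\<^sup>2 - 1"
proof -
  define E where "E = exp 1 * x"
  define u where "u = y / E"
  have E: "E > 0" using x by (simp add: E_def)
  have u: "0 < u" "u \<le> 1" using y E by (auto simp: u_def E_def)
  have "1 - u = (E - y) / E" using E by (simp add: u_def diff_divide_distrib)
  also have "\<dots> \<le> 1 / E" using y E by (intro divide_right_mono) (auto simp: E_def)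
  finally have u': "1 - u \<le> 1 / E" .
  have lny: "ln y = ln u + 1 + ln x"
    using y x E by (simp add: u_def ln_div E_def ln_mult)
  have "1 - ln (u\<^sup>2) \<ge> 2 - u\<^sup>2" using ln_le_minus_one[of "u\<^sup>2"] u by simp
  then have "u\<^sup>2 * (1 - ln (u\<^sup>2)) \<ge> u\<^sup>2 * (2 - u\<^sup>2)" by (intro mult_left_mono) auto
  also have "u\<^sup>2 * (2 - u\<^sup>2) = 1 - (1 - u)\<^sup>2 * (1 + u)\<^sup>2" by (simp add: power2_eq_square algebra_simps)
  finally have "u\<^sup>2 * (1 - ln (u\<^sup>2)) \<ge> 1 - (1 - u)\<^sup>2 * (1 + u)\<^sup>2" by simp
  moreover have "(1 - u)\<^sup>2 * (1 + u)\<^sup>2 \<le> (1 / E)\<^sup>2 * 2\<^sup>2"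
    using u u' by (intro mult_mono power_mono) auto
  ultimately have "E\<^sup>2 / 4 * (u\<^sup>2 * (1 - ln (u\<^sup>2))) \<ge> E\<^sup>2 / 4 * (1 - (1 / E)\<^sup>2 * 2\<^sup>2)"
    by (intro mult_left_mono) auto
  also have "E\<^sup>2 / 4 * (1 - (1 / E)\<^sup>2 * 2\<^sup>2) = E\<^sup>2 / 4 - 1" using E by (simp add: field_simps)
  also have "E\<^sup>2 / 4 * (u\<^sup>2 * (1 - ln (u\<^sup>2))) = y\<^sup>2 / 4 * (1 - ln (u\<^sup>2))"
    using E by (simp add: u_def power_divide)
  also have "\<dots> = Psi x y"
    unfolding Psi_def lny using u by (simp add: ln_realpow field_simps)
  finally show ?thesis by (simp add: E_def power_mult_distrib)
qed

text \<open>Here \<open>g\<close> is the Stirling form of \<open>ln (x^n / n!)\<close>; comparing it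
  with increments of \<open>Psi\<close> makes the sums telescope. The second bound stops at the
  maximum of \<open>Psi\<close>, where \<open>ln n \<le> 1 + ln x\<close> still keeps the error
  constant.\<close>

lemma Psi_diff_bounds:
  assumes n: "n > 0" and x: "x \<ge> 1"
  defines "g \<equiv> real n * (1 + ln x - ln (real n))"
  shows "Psi x (real (n + 1)) - Psi x (real n) \<le> g + 1 / 4 + ln x / 2"
    and "real n \<le> exp 1 * x \<Longrightarrow> g \<le> Psi x (real (n + 1)) - Psi x (real n) + 2"
proof -
  define d where "d = ln (real (n + 1)) - ln (real n)"
  have n0: "real n > 0" using n by simp
  have eq: "Psi x (real (n + 1)) - Psi x (real n) = g + real n / 2 + 3 / 4 + ln x / 2 - (real n + 1)\<^sup>2 / 2 * d - ln (real n) / 2"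
  proof -
    have "ln (real (n + 1)) = ln (real n) + d" by (simp add: d_def)
    then show ?thesis unfolding Psi_def g_def by simp (simp add: power2_eq_square field_simps)
  qed
  have "(real n + 1)\<^sup>2 / 2 * (1 / real (n + 1)) \<le> (real n + 1)\<^sup>2 / 2 * d"
    unfolding d_def by (intro mult_left_mono ln_Suc_div_bounds n) auto
  moreover have "(real n + 1)\<^sup>2 / 2 * (1 / real (n + 1)) = (real n + 1) / 2"
  proof -
    have "k\<^sup>2 / 2 * (1 / k) = k / 2" if "k > 0" for k :: real
      using that by (simp add: power2_eq_square)
    from this[of "real n + 1"] show ?thesis by (simp add: add.commute)
  qed
  ultimately have 1: "(real n + 1) / 2 \<le> (real n + 1)\<^sup>2 / 2 * d" by simp
  have "(real n + 1)\<^sup>2 / 2 * d \<le> (real n + 1)\<^sup>2 / 2 * (1 / real n)"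
    unfolding d_def by (intro mult_left_mono ln_Suc_div_bounds n) auto
  also have "\<dots> = real n / 2 + 1 + 1 / (2 * real n)" using n0 by (simp add: power2_eq_square field_simps)
  also have "\<dots> \<le> real n / 2 + 3 / 2" using n by (simp add: field_simps)
  finally have 2: "(real n + 1)\<^sup>2 / 2 * d \<le> real n / 2 + 3 / 2" .
  have "ln (real n) \<ge> 0" using n by simp
  with eq 1 show "Psi x (real (n + 1)) - Psi x (real n) \<le> g + 1 / 4 + ln x / 2" by (simp add: field_simps)
  assume "real n \<le> exp 1 * x"
  then have "ln (real n) \<le> ln (exp 1 * x)" using n0 by (subst ln_le_cancel_iff) (use x in auto)
  then have "ln (real n) \<le> 1 + ln x" using x by (simp add: ln_mult)
  with eq 2 show "g \<le> Psi x (real (n + 1)) - Psi x (real n) + 2" by (simp add: field_simps)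
qed

text \<open>For \<open>x = (r - 2)^2\<close> this sum is the logarithm of the Vandermonde gain in
  the upper bound. Cutting at \<open>N\<close> near \<open>e * x\<close> stops where the summands
  change sign to leading order.\<close>

lemma sum_ln_power_div_fact_ge:
  assumes x: "x \<ge> 1" and N: "N > 0" "real N \<le> exp 1 * x" "exp 1 * x - 1 \<le> real N"
  shows "(\<Sum>n<N. real n * ln x - ln (fact n))
    \<ge> (exp 1)\<^sup>2 / 4 * x\<^sup>2 - 2 - ln x / 2 - real N * (5 / 4 + ln x / 2 + ln (real N))"
proof -
  have step: "Psi x (real (n + 1)) - Psi x (real n) - (5 / 4 + ln x / 2 + ln (real N)) \<le> real n * ln x - ln (fact n)"
    if n: "n > 0" "n < N" for n
  proof -
    have "ln (real n) \<le> ln (real N)" using n by simp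
    then show ?thesis
      using Psi_diff_bounds(1)[OF n(1) x] ln_fact_le[OF n(1)] by (simp add: algebra_simps)
  qed
  have tele: "(\<Sum>n=1..<N. Psi x (real (n + 1)) - Psi x (real n)) = Psi x (real N) - Psi x 1"
    using sum_Suc_diff'[of 1 N "\<lambda>n. Psi x (real n)"] N by simp
  have "Psi x (real N) - Psi x 1 - real N * (5 / 4 + ln x / 2 + ln (real N))
    \<le> Psi x (real N) - Psi x 1 - real (N - 1) * (5 / 4 + ln x / 2 + ln (real N))"
    using x N by (intro diff_left_mono mult_right_mono) auto
  also have "\<dots> = (\<Sum>n=1..<N. Psi x (real (n + 1)) - Psi x (real n) - (5 / 4 + ln x / 2 + ln (real N)))"
    by (subst sum_subtractf) (simp only: tele, simp)
  also have "\<dots> \<le> (\<Sum>n=1..<N. real n * ln x - ln (fact n))" by (intro sum_mono step) auto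
  also have "\<dots> = (\<Sum>n<N. real n * ln x - ln (fact n))"
    by (rule sum.mono_neutral_left) (auto simp: not_less_eq_eq)
  finally have "Psi x (real N) - Psi x 1 - real N * (5 / 4 + ln x / 2 + ln (real N)) \<le> (\<Sum>n<N. real n * ln x - ln (fact n))" .
  moreover have "Psi x (real N) \<ge> (exp 1)\<^sup>2 / 4 * x\<^sup>2 - 1" using N x by (intro Psi_ge) auto
  moreover have "Psi x 1 = 3 / 4 + ln x / 2" by (simp add: Psi_def)
  ultimately show ?thesis by linarith
qed

text \<open>The bound is uniform in \<open>L\<close>: beyond \<open>e * x\<close> the positive parts
  vanish, and up to there the telescoped sum is at most the maximum of \<open>Psi\<close>.\<close>

lemma sum_max_ln_power_div_fact_le:
  assumes x: "x \<ge> 1"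
  shows "(\<Sum>n=1..<L. max 0 (real n * ln x - ln (fact n))) \<le> (exp 1)\<^sup>2 / 4 * x\<^sup>2 + 2 * exp 1 * x"
proof -
  define m where "m = nat \<lfloor>exp 1 * x\<rfloor>"
  have m: "real m \<le> exp 1 * x" using x by (simp add: m_def)
  have n_le: "n \<le> m \<longleftrightarrow> real n \<le> exp 1 * x" for n
    using x by (simp add: m_def nat_le_iff le_nat_iff le_floor_iff)
  have le_g: "real n * ln x - ln (fact n) \<le> real n * (1 + ln x - ln (real n))" if "n > 0" for n
    using ln_fact_ge[OF that] by (simp add: algebra_simps)
  have step: "max 0 (real n * ln x - ln (fact n)) \<le> (if n \<le> m then Psi x (real (n + 1)) - Psi x (real n) + 2 else 0)"
    if n: "n > 0" for n
  proof (cases "n \<le> m")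
    case True
    then have le: "real n \<le> exp 1 * x" using n_le by simp
    then have "ln (real n) \<le> ln (exp 1 * x)" using n by (subst ln_le_cancel_iff) (use x in auto)
    then have "0 \<le> 1 + ln x - ln (real n)" using x by (simp add: ln_mult)
    then have "0 \<le> real n * (1 + ln x - ln (real n))" by simp
    with le_g[OF n] Psi_diff_bounds(2)[OF n x le] True show ?thesis by auto
  next
    case False
    then have "exp 1 * x \<le> real n" using n_le by simp
    then have "ln (exp 1 * x) \<le> ln (real n)" using n by (subst ln_le_cancel_iff) (use x in auto)
    then have "1 + ln x - ln (real n) \<le> 0" using x by (simp add: ln_mult)
    then have "real n * (1 + ln x - ln (real n)) \<le> 0" by (intro mult_nonneg_nonpos) auto
    with le_g[OF n] False show ?thesis by auto
  qed
  have "(\<Sum>n=1..<L. max 0 (real n * ln x - ln (fact n))) \<le> (\<Sum>n=1..<max L (m + 1). max 0 (real n * ln x - ln (fact n)))"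
    by (intro sum_mono2) auto
  also have "\<dots> \<le> (\<Sum>n=1..<max L (m + 1). if n \<le> m then Psi x (real (n + 1)) - Psi x (real n) + 2 else 0)"
    by (intro sum_mono step) auto
  also have "\<dots> = (\<Sum>n=1..<m+1. Psi x (real (n + 1)) - Psi x (real n) + 2)"
    by (rule sum.mono_neutral_cong_right) auto
  also have "\<dots> = Psi x (real (m + 1)) - Psi x 1 + 2 * real m"
    using sum_Suc_diff'[of 1 "m + 1" "\<lambda>n. Psi x (real n)"] by (simp add: sum.distrib)
  also have "\<dots> \<le> (exp 1)\<^sup>2 / 4 * x\<^sup>2 - 0 + 2 * (exp 1 * x)"
    using x m by (intro add_mono diff_mono Psi_le mult_left_mono) (auto simp: Psi_def)
  finally show ?thesis by simp
qed

text \<open>The free parameter \<open>l\<close> buys geometric decay of ratio \<open>1 / l\<close>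
  at the price of a factor independent of \<open>n\<close>. The value \<open>l = 2\<close> serves
  for the growth of the series, \<open>l = 16\<close> for its tail in the lower bound.\<close>

lemma power_div_sqrt_fact_le:
  fixes r l :: real
  assumes r: "r \<ge> 0" and l: "l > 0"
  shows "r ^ n / sqrt (fact n) \<le> exp (l\<^sup>2 * r\<^sup>2 / 2) * (1 / l) ^ n"
proof -
  have "((l * r) ^ n / sqrt (fact n))\<^sup>2 = ((l * r)\<^sup>2) ^ n / fact n"
    by (simp add: power_divide flip: power_mult) (simp add: mult.commute)
  also have "\<dots> \<le> exp ((l * r)\<^sup>2)" by (rule power_div_fact_le_exp) simp
  also have "\<dots> = (exp (l\<^sup>2 * r\<^sup>2 / 2))\<^sup>2"
    by (simp add: power2_eq_square power_mult_distrib flip: exp_add)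
  finally have "(l * r) ^ n / sqrt (fact n) \<le> exp (l\<^sup>2 * r\<^sup>2 / 2)"
    by (rule power2_le_imp_le) simp
  then show ?thesis using l by (simp add: power_mult_distrib field_simps)
qed

section \<open>Means of zero-free functions over roots of unity\<close>

text \<open>The point \<open>- cnj b\<close> is the mirror image of \<open>b\<close> in the
  imaginary axis, and \<open>a\<close> lies on the side of \<open>b\<close>.\<close>

lemma cmod_diff_less_cmod_add_cnj:
  fixes a b :: complex
  assumes "Re a > 0" "Re b > 0"
  shows "cmod (a - b) < cmod (a + cnj b)"
proof -
  have "(cmod (a + cnj b))\<^sup>2 - (cmod (a - b))\<^sup>2 = 4 * (Re a * Re b)"
    by (simp add: cmod_power2) (simp add: power2_eq_square algebra_simps)
  moreover have "0 < Re a * Re b" using assms by (rule mult_pos_pos)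
  ultimately have "(cmod (a - b))\<^sup>2 < (cmod (a + cnj b))\<^sup>2" by linarith
  then show ?thesis by (rule power_less_imp_less_base) simp
qed

text \<open>The Cayley transform \<open>W\<close> sends the right half-plane to the unit disc and
  \<open>G 0\<close> to 0, so the Schwarz lemma applies; the resulting inequality is then solved for
  \<open>G z - G 0\<close>.\<close>

lemma Borel_Caratheodory_pos_Re:
  fixes G :: "complex \<Rightarrow> complex"
  assumes hol: "G holomorphic_on ball 0 r" and pos: "\<And>z. cmod z < r \<Longrightarrow> Re (G z) > 0"
    and r: "0 \<le> R" "R < r" and z: "cmod z \<le> R"
  shows "cmod (G z - G 0) \<le> 2 * R / (r - R) * Re (G 0)"
proof -
  have r0: "r > 0" using r by simp
  have P0: "Re (G 0) > 0" using pos[of 0] r0 by simp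
  define W where "W = (\<lambda>w. (G (of_real r * w) - G 0) / (G (of_real r * w) + cnj (G 0)))"
  have in_ball: "cmod (of_real r * w) < r" if "cmod w < 1" for w
    using that r0 by (simp add: norm_mult)
  have lt: "cmod (G (of_real r * w) - G 0) < cmod (G (of_real r * w) + cnj (G 0))" if "cmod w < 1" for w
    by (intro cmod_diff_less_cmod_add_cnj pos in_ball that P0)
  have "W holomorphic_on ball 0 1"
    unfolding W_def
  proof (intro holomorphic_intros)
    have "(G \<circ> (\<lambda>w. of_real r * w)) holomorphic_on ball 0 1"
      by (rule holomorphic_on_compose_gen[OF _ hol]) (auto intro!: holomorphic_intros in_ball)
    then show "(\<lambda>w. G (of_real r * w)) holomorphic_on ball 0 1"
      "(\<lambda>w. G (of_real r * w)) holomorphic_on ball 0 1" by (simp_all add: o_def)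
  qed (use lt in force)
  moreover have "W 0 = 0" by (simp add: W_def)
  moreover have "cmod (W w) < 1" if "cmod w < 1" for w
    using lt[OF that] unfolding W_def norm_divide
    by (metis divide_less_eq_1_pos norm_ge_zero order_le_less_trans)
  moreover have "cmod (z / of_real r) < 1" using z r r0 by (simp add: norm_divide)
  ultimately have "cmod (W (z / of_real r)) \<le> cmod (z / of_real r)"
    by (rule Schwarz_Lemma(1))
  also have "\<dots> \<le> R / r" using z r0 by (simp add: norm_divide divide_right_mono)
  finally have *: "cmod (G z - G 0) / cmod (G z + cnj (G 0)) \<le> R / r"
    using r0 by (simp add: W_def norm_divide)
  have "cmod (G z - G 0) < cmod (G z + cnj (G 0))"
    using lt[of "z / of_real r"] \<open>cmod (z / of_real r) < 1\<close> r0 by simp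
  then have "cmod (G z + cnj (G 0)) > 0"
    by (metis norm_ge_zero order_le_less_trans)
  with * r0 have "r * cmod (G z - G 0) \<le> R * cmod (G z + cnj (G 0))"
    by (simp add: field_simps)
  also have "\<dots> \<le> R * (cmod (G z - G 0) + cmod (of_real (2 * Re (G 0))))"
  proof (intro mult_left_mono r)
    have "G z + cnj (G 0) = (G z - G 0) + of_real (2 * Re (G 0))"
      by (simp add: complex_eq_iff)
    then show "cmod (G z + cnj (G 0)) \<le> cmod (G z - G 0) + cmod (of_real (2 * Re (G 0)))"
      by (metis norm_triangle_ineq)
  qed
  also have "cmod (of_real (2 * Re (G 0))) = 2 * Re (G 0)" using P0 by (subst norm_of_real) simp
  finally have "(r - R) * cmod (G z - G 0) \<le> 2 * R * Re (G 0)" by (simp add: algebra_simps)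
  then show ?thesis using r by (simp add: field_simps)
qed

lemma sum_cis_power_eq_0:
  assumes "0 < k" "k < N"
  shows "(\<Sum>j<N. cis (2 * pi * real j / real N) ^ k) = 0"
proof -
  define w where "w = cis (2 * pi * real k / real N)"
  have "w \<noteq> 1"
  proof
    assume "w = 1"
    then have "exp (2 * of_real pi * \<i> * of_nat k / of_nat N) = (1::complex)"
      by (simp add: w_def cis_conv_exp mult_ac)
    then show False using complex_root_unity_eq_1[of N k] assms
      by (metis dvd_imp_le not_less One_nat_def Suc_leI less_trans)
  qed
  moreover have "w ^ N = 1"
  proof -
    have "real N * (2 * pi * real k / real N) = 2 * pi * real k" using assms by simp
    then show ?thesis unfolding w_def Complex.DeMoivre by (simp only:) (simp add: cis_multiple_2pi)
  qed
  moreover have "cis (2 * pi * real j / real N) ^ k = w ^ j" for j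
    by (simp add: w_def Complex.DeMoivre mult_ac)
  ultimately show ?thesis by (simp add: sum_gp_strict)
qed

text \<open>Summation over the nodes kills the powers of index strictly between 0 and
  \<open>N\<close>. The remaining coefficients are bounded by Cauchy on radius \<open>r - 1\<close>,
  where Borel-Caratheodory gives \<open>2 * r * Re (G 0)\<close>; on radius \<open>r - 2\<close>
  this leaves a geometric series of ratio \<open>(r - 2) / (r - 1)\<close>, whose sum produces the
  factor \<open>r - 1\<close>.\<close>

lemma mean_at_roots_of_unity:
  fixes G :: "complex \<Rightarrow> complex"
  assumes hol: "G holomorphic_on ball 0 r" and pos: "\<And>z. cmod z < r \<Longrightarrow> Re (G z) > 0"
    and r: "2 < r" and N: "0 < N"
  shows "cmod ((\<Sum>j<N. G (of_real (r - 2) * cis (2 * pi * real j / real N))) - of_nat N * G 0)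
    \<le> real N * (2 * r * (r - 1) * ((r - 2) / (r - 1)) ^ N) * Re (G 0)"
proof -
  define c where "c = (\<lambda>n. (deriv ^^ n) G 0 / fact n)"
  define z where "z = (\<lambda>j. of_real (r - 2) * cis (2 * pi * real j / real N))"
  have nz: "cmod (z j) = r - 2" for j using r by (simp add: z_def norm_mult del: of_real_diff)
  have P0: "Re (G 0) > 0" using pos[of 0] r by simp
  have cb: "cmod (c n) \<le> 2 * r * Re (G 0) / (r - 1) ^ n" if "n > 0" for n
  proof -
    have sub: "cball 0 (r - 1) \<subseteq> ball (0::complex) r" using r by auto
    have "cmod ((deriv ^^ n) (\<lambda>z. G z - G 0) 0) \<le> fact n * (2 * r * Re (G 0)) / (r - 1) ^ n"
    proof (rule Cauchy_inequality)
      show "(\<lambda>z. G z - G 0) holomorphic_on ball 0 (r - 1)"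
        by (intro holomorphic_intros holomorphic_on_subset[OF hol]) auto
      show "continuous_on (cball 0 (r - 1)) (\<lambda>z. G z - G 0)"
        by (intro continuous_intros holomorphic_on_imp_continuous_on holomorphic_on_subset[OF hol] sub)
      fix x :: complex assume "cmod (0 - x) = r - 1"
      then have "cmod (G x - G 0) \<le> 2 * (r - 1) / (r - (r - 1)) * Re (G 0)"
        using r by (intro Borel_Caratheodory_pos_Re[OF hol pos]) auto
      also have "\<dots> \<le> 2 * r * Re (G 0)" using P0 by (simp add: algebra_simps)
      finally show "cmod (G x - G 0) \<le> 2 * r * Re (G 0)" .
    qed (use r in auto)
    also have "(deriv ^^ n) (\<lambda>z. G z - G 0) 0 = (deriv ^^ n) G 0 - (deriv ^^ n) (\<lambda>z. G 0) 0"
      using r by (intro higher_deriv_diff[OF hol]) auto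
    also have "(deriv ^^ n) (\<lambda>z. G 0) 0 = 0"
      using that by (simp add: higher_deriv_const)
    finally show ?thesis by (simp add: c_def norm_divide field_simps)
  qed
  have sumsG: "(\<lambda>n. c n * z j ^ n) sums G (z j)" for j
    using holomorphic_power_series[OF hol, of "z j"] nz[of j] r by (simp add: c_def)
  have s1: "(\<lambda>n. c n * (\<Sum>j<N. z j ^ n)) sums (\<Sum>j<N. G (z j))"
    using sums_sum[of "{..<N}" "\<lambda>j n. c n * z j ^ n"] sumsG by (simp add: sum_distrib_left)
  have zs: "(\<Sum>j<N. z j ^ n) = of_real (r - 2) ^ n * (\<Sum>j<N. cis (2 * pi * real j / real N) ^ n)" for n
    by (simp add: z_def power_mult_distrib sum_distrib_left)
  have z0: "c n * (\<Sum>j<N. z j ^ n) = 0" if "0 < n" "n < N" for n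
    using that by (simp add: zs sum_cis_power_eq_0)
  have "(\<Sum>n<N. c n * (\<Sum>j<N. z j ^ n)) = (\<Sum>n<N. if n = 0 then of_nat N * G 0 else 0)"
    by (intro sum.cong refl) (use z0 in \<open>auto simp: c_def\<close>)
  also have "\<dots> = of_nat N * G 0" using N by simp
  finally have s2: "(\<lambda>n. c (n + N) * (\<Sum>j<N. z j ^ (n + N))) sums ((\<Sum>j<N. G (z j)) - of_nat N * G 0)"
    using s1 sums_iff_shift[of "\<lambda>n. c n * (\<Sum>j<N. z j ^ n)" N] by (simp add: algebra_simps)
  define q where "q = (r - 2) / (r - 1)"
  have q: "0 < q" "q < 1" using r by (auto simp: q_def)
  have bd: "cmod (c (n + N) * (\<Sum>j<N. z j ^ (n + N))) \<le> real N * (2 * r * Re (G 0)) * q ^ N * q ^ n" for n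
  proof -
    have "cmod (\<Sum>j<N. z j ^ (n + N)) \<le> real N * (r - 2) ^ (n + N)"
      using sum_norm_bound[of "{..<N}" "\<lambda>j. z j ^ (n + N)" "(r - 2) ^ (n + N)"]
      by (simp add: norm_power nz)
    then have "cmod (c (n + N) * (\<Sum>j<N. z j ^ (n + N))) \<le> (2 * r * Re (G 0) / (r - 1) ^ (n + N)) * (real N * (r - 2) ^ (n + N))"
      unfolding norm_mult using r P0 N by (intro mult_mono cb) auto
    also have "\<dots> = real N * (2 * r * Re (G 0)) * q ^ (n + N)"
      by (simp add: q_def power_divide)
    finally show ?thesis by (simp add: power_add mult_ac)
  qed
  have gs: "(\<lambda>n. real N * (2 * r * Re (G 0)) * q ^ N * q ^ n) sums (real N * (2 * r * Re (G 0)) * q ^ N * (1 / (1 - q)))"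
    by (intro sums_mult geometric_sums) (use q in auto)
  have "cmod ((\<Sum>j<N. G (z j)) - of_nat N * G 0) \<le> real N * (2 * r * Re (G 0)) * q ^ N * (1 / (1 - q))"
    using norm_suminf_le[OF bd sums_summable[OF gs]] sums_unique[OF s2] sums_unique[OF gs] by simp
  also have "1 / (1 - q) = r - 1" using r by (simp add: q_def field_simps)
  finally show ?thesis by (simp only: z_def q_def mult_ac)
qed

text \<open>A zero-free \<open>f\<close> has a holomorphic logarithm \<open>g\<close>, and
  \<open>|f| < exp B\<close> makes the real part of \<open>B - g\<close> positive, so the previous
  estimate applies and its real part is read off.\<close>

lemma sum_ln_cmod_at_roots_of_unity:
  fixes f :: "complex \<Rightarrow> complex"
  assumes hol: "f holomorphic_on ball 0 r" and nz: "\<And>z. cmod z < r \<Longrightarrow> f z \<noteq> 0"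
    and bd: "\<And>z. cmod z < r \<Longrightarrow> cmod (f z) < exp B"
    and r: "2 < r" and N: "0 < N"
  defines "e \<equiv> 2 * r * (r - 1) * ((r - 2) / (r - 1)) ^ N"
  shows "(\<Sum>j<N. ln (cmod (f (of_real (r - 2) * cis (2 * pi * real j / real N)))))
    \<le> real N * (e * B + (1 - e) * ln (cmod (f 0)))"
proof -
  obtain g where g: "g holomorphic_on ball 0 r" "\<And>x. x \<in> ball 0 r \<Longrightarrow> exp (g x) = f x"
    using holomorphic_logarithm_exists[of "ball 0 r" f 0] hol nz r by auto
  define G where "G = (\<lambda>z. of_real B - g z)"
  define z where "z = (\<lambda>j. of_real (r - 2) * cis (2 * pi * real j / real N))"
  have nzz: "cmod (z j) < r" for j using r by (simp add: z_def norm_mult del: of_real_diff)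
  have Reg: "Re (g z) = ln (cmod (f z))" if "cmod z < r" for z
    using g(2)[of z] that by (metis dist_0_norm exp_gt_zero ln_exp mem_ball norm_exp_eq_Re)
  have ReG: "Re (G z) = B - ln (cmod (f z))" if "cmod z < r" for z
    using Reg[OF that] by (simp add: G_def)
  have pos: "Re (G z) > 0" if "cmod z < r" for z
    using ReG[OF that] bd[OF that] nz[OF that] by (metis diff_gt_0_iff_gt exp_gt_zero ln_exp ln_less_cancel_iff zero_less_norm_iff)
  have holG: "G holomorphic_on ball 0 r" unfolding G_def by (intro holomorphic_intros g)
  have "\<bar>Re ((\<Sum>j<N. G (z j)) - of_nat N * G 0)\<bar> \<le> real N * e * Re (G 0)"
    using mean_at_roots_of_unity[OF holG pos r N] abs_Re_le_cmod order_trans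
    unfolding z_def e_def by blast
  moreover have "Re ((\<Sum>j<N. G (z j)) - of_nat N * G 0) = real N * B - (\<Sum>j<N. ln (cmod (f (z j)))) - real N * Re (G 0)"
    by (simp add: ReG nzz sum_subtractf)
  moreover have "Re (G 0) = B - ln (cmod (f 0))" using ReG r by simp
  ultimately have "real N * B - (\<Sum>j<N. ln (cmod (f (z j)))) - real N * (B - ln (cmod (f 0))) \<ge> - (real N * e * (B - ln (cmod (f 0))))"
    by (metis abs_le_D2 minus_le_iff)
  then have "(\<Sum>j<N. ln (cmod (f (z j)))) \<le> real N * (e * B + (1 - e) * ln (cmod (f 0)))"
    by (simp add: algebra_simps)
  then show ?thesis by (simp only: z_def)
qed

section \<open>Integration over polynomial coefficients\<close>

text \<open>The product of the differences is the derivative of \<open>X^N - 1\<close> at the node,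
  of modulus \<open>N\<close>.\<close>

lemma prod_diff_roots_of_unity:
  assumes i: "i < N"
  shows "(\<Prod>j\<in>{..<N} - {i}. cmod (cis (2 * pi * real i / real N) - cis (2 * pi * real j / real N))) = real N"
proof -
  define w where "w = (\<lambda>k. cis (2 * pi * real k / real N))"
  have N: "N > 0" using i by simp
  have bij: "bij_betw w {..<N} {z. z ^ N = 1}" unfolding w_def by (rule Complex.bij_betw_roots_unity[OF N])
  then have inj: "inj_on w {..<N}" by (rule bij_betw_imp_inj_on)
  have root: "w k ^ N = 1" if "k < N" for k using bij that by (auto simp: bij_betw_def)
  define P where "P = (\<Prod>j<N. [:- w j, 1:])"
  have "P = monom 1 N - 1"
  proof (rule poly_eqI_degree_lead_coeff[where A = "w ` {..<N}" and n = N])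
    show "card (w ` {..<N}) \<ge> N" using inj by (simp add: card_image)
    show "degree P \<le> N" unfolding P_def by (rule order_trans[OF degree_prod_sum_le]) auto
    show "degree (monom 1 N - 1 :: complex poly) \<le> N" by (intro degree_diff_le) (auto simp: degree_monom_le)
    show "coeff P N = coeff (monom 1 N - 1) N"
    proof -
      have "degree P = N" unfolding P_def by (subst degree_prod_eq_sum_degree) auto
      then have "coeff P N = lead_coeff P" by simp
      also have "\<dots> = 1" unfolding P_def lead_coeff_prod by simp
      finally show ?thesis using N by simp
    qed
    fix x assume "x \<in> w ` {..<N}"
    then show "poly P x = poly (monom 1 N - 1) x"
      by (auto simp: P_def poly_prod poly_monom root prod_zero_iff)
  qed
  then have "poly (pderiv P) (w i) = of_nat N * w i ^ (N - 1)"
    by (simp add: pderiv_diff pderiv_monom poly_monom)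
  moreover have "poly (pderiv P) (w i) = (\<Sum>a<N. \<Prod>j\<in>{..<N} - {a}. w i - w j)"
    by (simp add: P_def pderiv_prod poly_sum poly_prod pderiv_pCons)
  \<comment> \<open>In the product rule every summand with \<open>a \<noteq> i\<close> contains the
    factor \<open>w i - w i\<close>.\<close>
  moreover have "\<dots> = (\<Sum>a<N. if a = i then \<Prod>j\<in>{..<N} - {i}. w i - w j else 0)"
    by (intro sum.cong refl) (use i in \<open>auto intro!: prod_zero\<close>)
  moreover have "\<dots> = (\<Prod>j\<in>{..<N} - {i}. w i - w j)" using i by simp
  ultimately have "cmod (\<Prod>j\<in>{..<N} - {i}. w i - w j) = cmod (of_nat N * w i ^ (N - 1))"
    by simp
  then show ?thesis by (simp add: norm_mult norm_power prod_norm w_def)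
qed

text \<open>Each unordered pair occurs twice on the right. For distances this turns the squared
  Vandermonde determinant into a product over nodes, each factor of which the preceding lemma
  evaluates.\<close>

lemma prod_lessThan_square_symmetric:
  fixes g :: "nat \<Rightarrow> nat \<Rightarrow> real"
  assumes "\<And>i j. g i j = g j i"
  shows "(\<Prod>j<N. \<Prod>i<j. (g j i)\<^sup>2) = (\<Prod>j<N. \<Prod>i\<in>{..<N} - {j}. g j i)"
proof (induction N)
  case (Suc N)
  have "(\<Prod>j<Suc N. \<Prod>i\<in>{..<Suc N} - {j}. g j i) = (\<Prod>j<N. \<Prod>i\<in>{..<Suc N} - {j}. g j i) * (\<Prod>i<N. g N i)"
  proof -
    have "{..<Suc N} - {N} = {..<N}" by auto
    then show ?thesis by simp
  qed
  also have "(\<Prod>j<N. \<Prod>i\<in>{..<Suc N} - {j}. g j i) = (\<Prod>j<N. g j N * (\<Prod>i\<in>{..<N} - {j}. g j i))"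
  proof (intro prod.cong refl)
    fix j assume "j \<in> {..<N}"
    then have "{..<Suc N} - {j} = insert N ({..<N} - {j})" by auto
    then show "(\<Prod>i\<in>{..<Suc N} - {j}. g j i) = g j N * (\<Prod>i\<in>{..<N} - {j}. g j i)" by simp
  qed
  also have "\<dots> = (\<Prod>j<N. g N j) * (\<Prod>j<N. \<Prod>i<j. (g j i)\<^sup>2)"
    by (simp add: prod.distrib Suc.IH assms[of _ N])
  finally show ?case by (simp add: power2_eq_square prod.distrib)
qed simp

section \<open>Lebesgue measure on the plane under affine maps\<close>

lemma nn_integral_lborel_translate:
  fixes h :: "complex \<Rightarrow> ennreal"
  assumes [measurable]: "h \<in> borel_measurable borel"
  shows "(\<integral>\<^sup>+z. h (c + z) \<partial>lborel) = (\<integral>\<^sup>+z. h z \<partial>lborel)"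
proof -
  have "(\<integral>\<^sup>+z. h z \<partial>lborel) = (\<integral>\<^sup>+z. h z \<partial>distr lborel borel ((+) c))"
    by (simp add: lborel_distr_plus)
  also have "\<dots> = (\<integral>\<^sup>+z. h (c + z) \<partial>lborel)"
    by (rule nn_integral_distr) auto
  finally show ?thesis ..
qed

lemma emeasure_lborel_complex_ball:
  assumes "r \<ge> 0" shows "emeasure lborel (ball (c::complex) r) = ennreal (pi * r\<^sup>2)"
  using emeasure_ball[OF assms, of c] by (simp add: unit_ball_vol_2)

text \<open>Fubini against the indicator of the unit disc, whose preimage under
  multiplication by \<open>a\<close> is again a disc, so no rotation invariance is needed beforehand.\<close>

lemma nn_integral_lborel_complex_mult:
  fixes h :: "complex \<Rightarrow> ennreal" and a :: complex
  assumes [measurable]: "h \<in> borel_measurable borel" and a: "a \<noteq> 0"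
  shows "(\<integral>\<^sup>+z. h (a * z) \<partial>lborel) = ennreal (1 / (cmod a)\<^sup>2) * (\<integral>\<^sup>+z. h z \<partial>lborel)"
proof -
  define D :: "complex \<Rightarrow> ennreal" where "D = indicator (ball 0 1)"
  have [measurable]: "D \<in> borel_measurable borel" unfolding D_def by (intro borel_measurable_indicator) auto
  have iD: "(\<integral>\<^sup>+y. D y \<partial>lborel) = ennreal pi"
    by (simp add: D_def emeasure_lborel_complex_ball)
  have "(\<integral>\<^sup>+x. h (a * x) \<partial>lborel) * ennreal pi = (\<integral>\<^sup>+y. D y * (\<integral>\<^sup>+x. h (a * x) \<partial>lborel) \<partial>lborel)"
    by (subst nn_integral_multc) (auto simp: iD mult.commute)
  also have "\<dots> = (\<integral>\<^sup>+y. (\<integral>\<^sup>+x. D y * h (a * x) \<partial>lborel) \<partial>lborel)"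
    by (intro nn_integral_cong nn_integral_cmult[symmetric]) auto
  \<comment> \<open>Translating \<open>x\<close> by \<open>y / a\<close> couples the two variables,
    so that after Fubini a translation of \<open>y\<close> moves the whole dependence on
    \<open>a\<close> into the indicator \<open>D\<close>.\<close>
  also have "\<dots> = (\<integral>\<^sup>+y. (\<integral>\<^sup>+x. D y * h (a * x + y) \<partial>lborel) \<partial>lborel)"
  proof (rule nn_integral_cong)
    fix y
    show "(\<integral>\<^sup>+x. D y * h (a * x) \<partial>lborel) = (\<integral>\<^sup>+x. D y * h (a * x + y) \<partial>lborel)"
      using nn_integral_lborel_translate[of "\<lambda>x. D y * h (a * x)" "y / a"] a
      by (simp add: distrib_left add.commute)
  qed
  also have "\<dots> = (\<integral>\<^sup>+x. (\<integral>\<^sup>+y. D y * h (a * x + y) \<partial>lborel) \<partial>lborel)"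
    by (rule lborel_pair.Fubini') measurable
  also have "\<dots> = (\<integral>\<^sup>+x. (\<integral>\<^sup>+y. D (y - a * x) * h y \<partial>lborel) \<partial>lborel)"
  proof (rule nn_integral_cong)
    fix x
    show "(\<integral>\<^sup>+y. D y * h (a * x + y) \<partial>lborel) = (\<integral>\<^sup>+y. D (y - a * x) * h y \<partial>lborel)"
      using nn_integral_lborel_translate[of "\<lambda>y. D (y - a * x) * h y" "a * x"] by simp
  qed
  also have "\<dots> = (\<integral>\<^sup>+y. (\<integral>\<^sup>+x. D (y - a * x) * h y \<partial>lborel) \<partial>lborel)"
    by (rule lborel_pair.Fubini') measurable
  also have "\<dots> = (\<integral>\<^sup>+y. ennreal (pi / (cmod a)\<^sup>2) * h y \<partial>lborel)"
  proof (rule nn_integral_cong)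
    fix y
    have "D (y - a * x) = indicator (ball (y / a) (1 / cmod a)) x" for x
    proof -
      have "cmod (y - a * x) = cmod a * cmod (y / a - x)"
        using a by (simp flip: norm_mult add: right_diff_distrib)
      moreover have "y - a * x \<in> ball 0 1 \<longleftrightarrow> cmod (y - a * x) < 1"
        by (metis dist_0_norm mem_ball)
      moreover have "x \<in> ball (y / a) (1 / cmod a) \<longleftrightarrow> cmod a * cmod (y / a - x) < 1"
        using a unfolding mem_ball dist_norm by (simp add: less_divide_eq mult.commute)
      ultimately have "y - a * x \<in> ball 0 1 \<longleftrightarrow> x \<in> ball (y / a) (1 / cmod a)" by simp
      then show ?thesis unfolding D_def indicator_def by simp
    qed
    then have "(\<integral>\<^sup>+x. D (y - a * x) \<partial>lborel) = ennreal (pi / (cmod a)\<^sup>2)"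
      by (simp add: emeasure_lborel_complex_ball power_divide)
    then show "(\<integral>\<^sup>+x. D (y - a * x) * h y \<partial>lborel) = ennreal (pi / (cmod a)\<^sup>2) * h y"
      by (subst nn_integral_multc) auto
  qed
  also have "\<dots> = ennreal (pi / (cmod a)\<^sup>2) * (\<integral>\<^sup>+y. h y \<partial>lborel)"
    by (rule nn_integral_cmult) auto
  also have "ennreal (pi / (cmod a)\<^sup>2) = ennreal pi * ennreal (1 / (cmod a)\<^sup>2)"
    by (simp flip: ennreal_mult)
  finally have "ennreal pi * (\<integral>\<^sup>+x. h (a * x) \<partial>lborel) = ennreal pi * (ennreal (1 / (cmod a)\<^sup>2) * (\<integral>\<^sup>+y. h y \<partial>lborel))"
    by (simp add: mult_ac)
  then show ?thesis by (subst (asm) ennreal_mult_cancel_left) auto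
qed

lemma nn_integral_lborel_complex_affine:
  fixes h :: "complex \<Rightarrow> ennreal" and a :: complex
  assumes [measurable]: "h \<in> borel_measurable borel" and a: "a \<noteq> 0"
  shows "(\<integral>\<^sup>+z. h (c + z * a) \<partial>lborel) = ennreal (1 / (cmod a)\<^sup>2) * (\<integral>\<^sup>+z. h z \<partial>lborel)"
  using nn_integral_lborel_complex_mult[of "\<lambda>z. h (c + z)" a] a
  by (simp add: nn_integral_lborel_translate mult.commute)

lemma product_sigma_finite_lborel: "product_sigma_finite (\<lambda>_::nat. lborel :: complex measure)"
  by standard

lemma nn_integral_PiM_lborel_translate:
  fixes f :: "(nat \<Rightarrow> complex) \<Rightarrow> ennreal"
  assumes I: "finite I" and [measurable]: "f \<in> borel_measurable (PiM I (\<lambda>_. lborel))"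
  shows "(\<integral>\<^sup>+x. f (\<lambda>n\<in>I. x n + v n) \<partial>PiM I (\<lambda>_. lborel)) = (\<integral>\<^sup>+x. f x \<partial>PiM I (\<lambda>_. lborel))"
proof -
  interpret lborel_PiM: product_sigma_finite "\<lambda>_::nat. lborel :: complex measure"
    by (rule product_sigma_finite_lborel)
  let ?P = "PiM I (\<lambda>_. lborel) :: (nat \<Rightarrow> complex) measure"
  let ?T = "\<lambda>x. \<lambda>n\<in>I. x n + v n"
  have T[measurable]: "?T \<in> measurable ?P ?P" by measurable
  have "distr ?P ?P ?T = ?P"
  proof (rule lborel_PiM.PiM_eqI[OF I])
    fix A :: "nat \<Rightarrow> complex set" assume A: "\<And>i. i \<in> I \<Longrightarrow> A i \<in> sets lborel"
    have "Pi\<^sub>E I A \<in> sets ?P" using A I by (intro sets_PiM_I_finite) auto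
    then have "emeasure (distr ?P ?P ?T) (Pi\<^sub>E I A) = emeasure ?P (?T -` Pi\<^sub>E I A \<inter> space ?P)"
      by (intro emeasure_distr T)
    also have "?T -` Pi\<^sub>E I A \<inter> space ?P = Pi\<^sub>E I (\<lambda>i. (\<lambda>x. v i + x) -` A i)"
      by (auto simp: space_PiM PiE_iff add.commute)
    also have "emeasure ?P \<dots> = (\<Prod>i\<in>I. emeasure lborel ((\<lambda>x. v i + x) -` A i))"
      using I by (intro lborel_PiM.emeasure_PiM)
        (auto intro!: measurable_sets_borel[OF _ A[unfolded sets_lborel]])
    also have "\<dots> = (\<Prod>i\<in>I. emeasure lborel (A i))"
    proof (intro prod.cong refl)
      fix i assume "i \<in> I"
      then have "emeasure (distr lborel borel ((+) (v i))) (A i) = emeasure lborel ((+) (v i) -` A i)"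
        using A by (subst emeasure_distr) auto
      then show "emeasure lborel ((+) (v i) -` A i) = emeasure lborel (A i)"
        by (simp add: lborel_distr_plus)
    qed
    finally show "emeasure (distr ?P ?P ?T) (Pi\<^sub>E I A) = (\<Prod>i\<in>I. emeasure lborel (A i))" .
  qed simp
  then show ?thesis
    using nn_integral_distr[OF T, of f] by simp
qed

text \<open>For a fixed leading coefficient \<open>y\<close>, a translation of the lower coefficients writes the
  polynomial as \<open>q + y * prod (w - z i)\<close>, where \<open>q\<close> has lower degree.  The second
  summand vanishes at the first \<open>N\<close> nodes, so the last node can be integrated out over \<open>y\<close>.\<close>

lemma nn_integral_polynomial_values:
  fixes z a :: "nat \<Rightarrow> complex" and h :: "nat \<Rightarrow> complex \<Rightarrow> ennreal"
  assumes inj: "inj_on z {..<N}" and a: "\<And>j. j < N \<Longrightarrow> a j \<noteq> 0"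
    and h: "\<And>j. h j \<in> borel_measurable borel"
  shows "(\<integral>\<^sup>+x. (\<Prod>j<N. h j (\<Sum>n<N. x n * (a n * z j ^ n))) \<partial>PiM {..<N} (\<lambda>_. lborel))
     = (\<Prod>j<N. ennreal (1 / ((cmod (a j))\<^sup>2 * (\<Prod>i<j. (cmod (z j - z i))\<^sup>2))) * (\<integral>\<^sup>+w. h j w \<partial>lborel))"
  using inj a
proof (induction N)
  case 0
  show ?case by (simp add: PiM_empty space_PiM emeasure_count_space)
next
  case (Suc N)
  interpret lborel_PiM: product_sigma_finite "\<lambda>_::nat. lborel :: complex measure"
    by (rule product_sigma_finite_lborel)
  note h[measurable]
  let ?PN = "PiM {..<N} (\<lambda>_. lborel) :: (nat \<Rightarrow> complex) measure"
  define P where "P = (\<Prod>i<N. [:- z i, 1:])"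
  have degP: "degree P = N" unfolding P_def by (subst degree_prod_eq_sum_degree) auto
  have lcP: "coeff P N = 1"
    using degP lead_coeff_prod[of "\<lambda>i. [:- z i, 1:]" "{..<N}"] by (simp add: P_def)
  have polyP: "poly P w = (\<Sum>n<N. coeff P n * w ^ n) + w ^ N" for w
    by (simp add: poly_altdef degP lcP flip: lessThan_Suc_atMost)
  have polyP': "poly P w = (\<Prod>i<N. w - z i)" for w by (simp add: P_def poly_prod)
  have polyP0: "poly P (z j) = 0" if "j < N" for j using that by (auto simp: polyP')
  define b where "b = a N * poly P (z N)"
  have b: "b \<noteq> 0"
    using Suc.prems(2)[of N] inj_onD[OF Suc.prems(1), of _ N] by (fastforce simp: b_def polyP')
  have aN: "a n \<noteq> 0" if "n < N" for n using Suc.prems that by auto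
  define q where "q = (\<lambda>x w. \<Sum>n<N. x n * (a n * w ^ n))"
  have q_meas[measurable]: "(\<lambda>x. q x w) \<in> borel_measurable ?PN" for w
    unfolding q_def by measurable
  define F where "F = (\<lambda>y x. (\<Prod>j<N. h j (q x (z j) + y * a N * z j ^ N)) * h N (q x (z N) + y * a N * z N ^ N))"
  have Fm[measurable]: "F y \<in> borel_measurable ?PN" for y unfolding F_def by measurable
  \<comment> \<open>The translation trades the top monomial for the monic polynomial
    \<open>P\<close> vanishing at the first \<open>N\<close> nodes. At the last node the factor of
    \<open>y\<close> becomes \<open>b\<close>, and \<open>(cmod b)^2\<close> is the Jacobian
    contributed by that node.\<close>
  have shift: "q (\<lambda>n\<in>{..<N}. x n + y * a N * coeff P n / a n) w + y * a N * w ^ N = q x w + y * a N * poly P w" for x y w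
  proof -
    have "q (\<lambda>n\<in>{..<N}. x n + y * a N * coeff P n / a n) w = (\<Sum>n<N. x n * (a n * w ^ n) + y * a N * (coeff P n * w ^ n))"
      unfolding q_def by (intro sum.cong refl) (simp add: aN field_simps)
    then show ?thesis
      by (simp add: q_def polyP distrib_left sum.distrib flip: sum_distrib_left)
  qed
  have "(\<integral>\<^sup>+x. (\<Prod>j<Suc N. h j (\<Sum>n<Suc N. x n * (a n * z j ^ n))) \<partial>PiM (insert N {..<N}) (\<lambda>_. lborel))
    = (\<integral>\<^sup>+y. (\<integral>\<^sup>+x. F y x \<partial>?PN) \<partial>lborel)"
  proof (subst lborel_PiM.product_nn_integral_insert_rev)
    show "(\<lambda>x. \<Prod>j<Suc N. h j (\<Sum>n<Suc N. x n * (a n * z j ^ n))) \<in> borel_measurable (PiM (insert N {..<N}) (\<lambda>_. lborel))"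
      unfolding lessThan_Suc[symmetric] by measurable
  qed (auto simp: F_def q_def mult_ac intro!: nn_integral_cong)
  also have "\<dots> = (\<integral>\<^sup>+y. (\<integral>\<^sup>+x. (\<Prod>j<N. h j (q x (z j))) * h N (q x (z N) + y * b) \<partial>?PN) \<partial>lborel)"
  proof (rule nn_integral_cong)
    fix y
    have "(\<integral>\<^sup>+x. F y x \<partial>?PN) = (\<integral>\<^sup>+x. F y (\<lambda>n\<in>{..<N}. x n + y * a N * coeff P n / a n) \<partial>?PN)"
      by (rule nn_integral_PiM_lborel_translate[symmetric]) auto
    also have "\<dots> = (\<integral>\<^sup>+x. (\<Prod>j<N. h j (q x (z j))) * h N (q x (z N) + y * b) \<partial>?PN)"
      unfolding F_def shift by (simp add: polyP0 b_def mult_ac)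
    finally show "(\<integral>\<^sup>+x. F y x \<partial>?PN) = (\<integral>\<^sup>+x. (\<Prod>j<N. h j (q x (z j))) * h N (q x (z N) + y * b) \<partial>?PN)" .
  qed
  also have "\<dots> = (\<integral>\<^sup>+x. (\<integral>\<^sup>+y. (\<Prod>j<N. h j (q x (z j))) * h N (q x (z N) + y * b) \<partial>lborel) \<partial>?PN)"
  proof -
    interpret P: sigma_finite_measure ?PN by (rule lborel_PiM.sigma_finite) simp
    interpret pair_sigma_finite "lborel :: complex measure" ?PN ..
    show ?thesis by (rule Fubini'[symmetric]) measurable
  qed
  also have "\<dots> = (\<integral>\<^sup>+x. (\<Prod>j<N. h j (q x (z j))) * (ennreal (1 / (cmod b)\<^sup>2) * (\<integral>\<^sup>+w. h N w \<partial>lborel)) \<partial>?PN)"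
    by (intro nn_integral_cong, subst nn_integral_cmult)
       (use b in \<open>auto simp: nn_integral_lborel_complex_affine\<close>)
  also have "\<dots> = (\<integral>\<^sup>+x. (\<Prod>j<N. h j (q x (z j))) \<partial>?PN) * (ennreal (1 / (cmod b)\<^sup>2) * (\<integral>\<^sup>+w. h N w \<partial>lborel))"
    by (rule nn_integral_multc) measurable
  also have "(\<integral>\<^sup>+x. (\<Prod>j<N. h j (q x (z j))) \<partial>?PN) =
    (\<Prod>j<N. ennreal (1 / ((cmod (a j))\<^sup>2 * (\<Prod>i<j. (cmod (z j - z i))\<^sup>2))) * (\<integral>\<^sup>+w. h j w \<partial>lborel))"
    unfolding q_def using Suc.prems by (intro Suc.IH) (auto simp: inj_on_def)
  also have "(cmod b)\<^sup>2 = (cmod (a N))\<^sup>2 * (\<Prod>i<N. (cmod (z N - z i))\<^sup>2)"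
    by (simp add: b_def polyP' norm_mult power_mult_distrib prod_power_distrib flip: prod_norm)
  finally show ?case by (simp only: lessThan_Suc prod.insert finite_lessThan lessThan_iff less_irrefl not_False_eq_True mult.commute)
qed

section \<open>Complex Gaussian sequences\<close>

text \<open>A bound \<open>c\<close> on each density becomes \<open>c ^ card I\<close> for the
  product. Stating it for integrals of arbitrary Borel functions lets Fubini drive the induction; it
  is applied with \<open>c = 1 / pi\<close>, the maximum of the Gaussian density.\<close>

lemma nn_integral_PiM_le_lborel:
  fixes \<nu> :: "nat \<Rightarrow> complex measure"
  assumes \<nu>: "product_sigma_finite \<nu>" "\<And>i. sets (\<nu> i) = sets borel"
    and le: "\<And>i f. f \<in> borel_measurable borel \<Longrightarrow> (\<integral>\<^sup>+x. f x \<partial>\<nu> i) \<le> c * (\<integral>\<^sup>+x. f x \<partial>lborel)"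
    and I: "finite I" and f: "f \<in> borel_measurable (PiM I (\<lambda>_. lborel))"
  shows "(\<integral>\<^sup>+x. f x \<partial>PiM I \<nu>) \<le> c ^ card I * (\<integral>\<^sup>+x. f x \<partial>PiM I (\<lambda>_. lborel))"
  using I f
proof (induction I arbitrary: f rule: finite_induct)
  case empty
  then show ?case by (simp add: PiM_empty)
next
  case (insert i I)
  interpret \<nu>: product_sigma_finite \<nu> by fact
  interpret lborel_PiM: product_sigma_finite "\<lambda>_::nat. lborel :: complex measure"
    by (rule product_sigma_finite_lborel)
  note [measurable] = insert.prems
  have sI: "sets (PiM J \<nu>) = sets (PiM J (\<lambda>_. lborel))" for J
    by (intro sets_PiM_cong) (auto simp: \<nu>)
  have f': "f \<in> borel_measurable (PiM (insert i I) \<nu>)"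
    using insert.prems by (simp cong: measurable_cong_sets add: sI)
  have "(\<integral>\<^sup>+x. f x \<partial>PiM (insert i I) \<nu>) = (\<integral>\<^sup>+x. (\<integral>\<^sup>+y. f (x(i := y)) \<partial>\<nu> i) \<partial>PiM I \<nu>)"
    by (rule \<nu>.product_nn_integral_insert[OF insert.hyps f'])
  also have "\<dots> \<le> (\<integral>\<^sup>+x. c * (\<integral>\<^sup>+y. f (x(i := y)) \<partial>lborel) \<partial>PiM I \<nu>)"
  proof (rule nn_integral_mono)
    fix x assume "x \<in> space (PiM I \<nu>)"
    then have x: "x \<in> space (PiM I (\<lambda>_. lborel))" using sets_eq_imp_space_eq[OF sI] by simp
    have "(\<lambda>y. x(i := y)) \<in> measurable lborel (PiM (insert i I) (\<lambda>_. lborel))"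
      by (rule measurable_component_update[OF x]) (use insert.hyps in auto)
    then have "(\<lambda>y. f (x(i := y))) \<in> borel_measurable lborel" by measurable
    then show "(\<integral>\<^sup>+y. f (x(i := y)) \<partial>\<nu> i) \<le> c * (\<integral>\<^sup>+y. f (x(i := y)) \<partial>lborel)"
      by (intro le) simp
  qed
  also have "\<dots> \<le> c ^ card I * (\<integral>\<^sup>+x. c * (\<integral>\<^sup>+y. f (x(i := y)) \<partial>lborel) \<partial>PiM I (\<lambda>_. lborel))"
    by (rule insert.IH) measurable
  also have "\<dots> = c ^ card I * (c * (\<integral>\<^sup>+x. (\<integral>\<^sup>+y. f (x(i := y)) \<partial>lborel) \<partial>PiM I (\<lambda>_. lborel)))"
    by (subst nn_integral_cmult) auto
  also have "(\<integral>\<^sup>+x. (\<integral>\<^sup>+y. f (x(i := y)) \<partial>lborel) \<partial>PiM I (\<lambda>_. lborel)) = (\<integral>\<^sup>+x. f x \<partial>PiM (insert i I) (\<lambda>_. lborel))"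
    by (rule lborel_PiM.product_nn_integral_insert[symmetric, OF insert.hyps insert.prems])
  finally show ?case using insert.hyps by (simp add: mult_ac)
qed

text \<open>Weierstrass' product inequality. For infinite \<open>I\<close> both sides are 1 by the
  default values of sum and product.\<close>

lemma one_minus_sum_le_prod:
  fixes q :: "nat \<Rightarrow> real"
  assumes "\<And>n. n \<in> I \<Longrightarrow> 0 \<le> q n \<and> q n \<le> 1"
  shows "1 - (\<Sum>n\<in>I. q n) \<le> (\<Prod>n\<in>I. 1 - q n)"
proof (cases "finite I")
  case True
  then show ?thesis using assms
  proof (induction I rule: finite_induct)
    case (insert i I)
    have "0 \<le> q i" "q i \<le> 1" using insert.prems by auto
    moreover have "0 \<le> (\<Sum>n\<in>I. q n)" by (rule sum_nonneg) (simp add: insert.prems)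
    moreover have "1 - (\<Sum>n\<in>I. q n) \<le> (\<Prod>n\<in>I. 1 - q n)" using insert by auto
    ultimately have "(1 - q i) * (1 - (\<Sum>n\<in>I. q n)) \<le> (1 - q i) * (\<Prod>n\<in>I. 1 - q n)"
      "0 \<le> q i * (\<Sum>n\<in>I. q n)"
      by (auto intro: mult_left_mono)
    then show ?case using insert.hyps by (simp add: algebra_simps)
  qed simp
qed simp

locale complex_gaussian_sequence = prob_space M for M :: "'a measure" +
  fixes \<phi> :: "nat \<Rightarrow> 'a \<Rightarrow> complex"
  assumes iid: "iid_std_complex_gaussian M \<phi>"
begin

lemma indep: "indep_vars (\<lambda>_. borel) \<phi> UNIV"
  using iid by (simp add: iid_std_complex_gaussian_def)

lemma distributed_gaussian: "distributed M lborel (\<phi> n) (\<lambda>z. ennreal (exp (- (cmod z)\<^sup>2) / pi))"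
  using iid by (simp add: iid_std_complex_gaussian_def)

lemma measurable_gaussian [measurable]: "\<phi> n \<in> borel_measurable M"
  using distributed_measurable[OF distributed_gaussian] by simp

lemma nn_integral_gaussian:
  assumes "g \<in> borel_measurable borel"
  shows "(\<integral>\<^sup>+\<omega>. g (\<phi> n \<omega>) \<partial>M) = (\<integral>\<^sup>+z. ennreal (exp (- (cmod z)\<^sup>2) / pi) * g z \<partial>lborel)"
  using distributed_nn_integral[OF distributed_gaussian, of g n] assms by simp

text \<open>The normalisation is read off from the existence of a variable with this density,
  without evaluating a Gaussian integral.\<close>

lemma nn_integral_gaussian_density: "(\<integral>\<^sup>+z. ennreal (exp (- (cmod z)\<^sup>2) / pi) \<partial>lborel) = 1"
  using nn_integral_gaussian[of "\<lambda>_. 1" 0] emeasure_space_1 by simp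

lemma emeasure_gaussian:
  assumes [measurable]: "S \<in> sets borel"
  shows "ennreal (prob {\<omega> \<in> space M. \<phi> n \<omega> \<in> S}) = (\<integral>\<^sup>+z. ennreal (exp (- (cmod z)\<^sup>2) / pi) * indicator S z \<partial>lborel)"
proof -
  have "ennreal (prob {\<omega> \<in> space M. \<phi> n \<omega> \<in> S}) = (\<integral>\<^sup>+\<omega>. indicator {\<omega> \<in> space M. \<phi> n \<omega> \<in> S} \<omega> \<partial>M)"
    by (simp add: emeasure_eq_measure)
  also have "\<dots> = (\<integral>\<^sup>+\<omega>. indicator S (\<phi> n \<omega>) \<partial>M)"
    by (intro nn_integral_cong) (auto split: split_indicator)
  also have "\<dots> = (\<integral>\<^sup>+z. ennreal (exp (- (cmod z)\<^sup>2) / pi) * indicator S z \<partial>lborel)"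
    by (rule nn_integral_gaussian) simp
  finally show ?thesis .
qed

lemma nn_integral_exp_half: "(\<integral>\<^sup>+z. ennreal (exp (- (cmod z)\<^sup>2 / 2) / pi) \<partial>lborel) = 2"
proof -
  have "(\<integral>\<^sup>+z. ennreal (exp (- (cmod (of_real (sqrt 2) * z))\<^sup>2 / 2) / pi) \<partial>lborel)
    = ennreal (1 / (cmod (of_real (sqrt 2)))\<^sup>2) * (\<integral>\<^sup>+z. ennreal (exp (- (cmod z)\<^sup>2 / 2) / pi) \<partial>lborel)"
    by (rule nn_integral_lborel_complex_mult) auto
  also have "(\<lambda>z. exp (- (cmod (of_real (sqrt 2) * z))\<^sup>2 / 2) / pi) = (\<lambda>z. exp (- (cmod z)\<^sup>2) / pi)"
    by (simp add: norm_mult power_mult_distrib)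
  finally have "1 = ennreal (1 / 2) * (\<integral>\<^sup>+z. ennreal (exp (- (cmod z)\<^sup>2 / 2) / pi) \<partial>lborel)"
    by (simp add: nn_integral_gaussian_density)
  then have "2 * 1 = (2 * ennreal (1 / 2)) * (\<integral>\<^sup>+z. ennreal (exp (- (cmod z)\<^sup>2 / 2) / pi) \<partial>lborel)"
    by (simp only: mult.assoc)
  also have "2 * ennreal (1 / 2) = ennreal (2 * (1 / 2))"
    by (subst ennreal_mult) auto
  finally show ?thesis by simp
qed

text \<open>Half of the exponent pays for the threshold, the other half stays integrable with
  integral 2. The true tail is \<open>exp (- A^2)\<close>, but the halved exponent suffices later
  because \<open>e^2 / 4 < 2\<close>.\<close>

lemma gaussian_tail:
  assumes "A \<ge> 0"
  shows "prob {\<omega> \<in> space M. cmod (\<phi> n \<omega>) > A} \<le> 2 * exp (- A\<^sup>2 / 2)"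
proof -
  have "ennreal (prob {\<omega> \<in> space M. cmod (\<phi> n \<omega>) > A}) = ennreal (prob {\<omega> \<in> space M. \<phi> n \<omega> \<in> {z. cmod z > A}})"
    by simp
  also have "\<dots> = (\<integral>\<^sup>+z. ennreal (exp (- (cmod z)\<^sup>2) / pi) * indicator {z. cmod z > A} z \<partial>lborel)"
    by (rule emeasure_gaussian) measurable
  also have "\<dots> \<le> (\<integral>\<^sup>+z. ennreal (exp (- A\<^sup>2 / 2)) * ennreal (exp (- (cmod z)\<^sup>2 / 2) / pi) \<partial>lborel)"
  proof (rule nn_integral_mono)
    fix z :: complex
    have "exp (- (cmod z)\<^sup>2) \<le> exp (- A\<^sup>2 / 2) * exp (- (cmod z)\<^sup>2 / 2)" if "cmod z > A"
    proof -
      have "A\<^sup>2 \<le> (cmod z)\<^sup>2" using that assms by (intro power_mono) auto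
      then show ?thesis by (simp flip: exp_add)
    qed
    then show "ennreal (exp (- (cmod z)\<^sup>2) / pi) * indicator {z. cmod z > A} z \<le> ennreal (exp (- A\<^sup>2 / 2)) * ennreal (exp (- (cmod z)\<^sup>2 / 2) / pi)"
      by (auto split: split_indicator simp flip: ennreal_mult intro!: ennreal_leI divide_right_mono)
  qed
  also have "\<dots> = ennreal (exp (- A\<^sup>2 / 2)) * 2"
    by (subst nn_integral_cmult, measurable) (simp only: nn_integral_exp_half)
  also have "\<dots> = ennreal (2 * exp (- A\<^sup>2 / 2))"
    by (simp add: ennreal_mult mult.commute)
  finally show ?thesis by (subst (asm) ennreal_le_iff) auto
qed

text \<open>Area of the disc times a lower bound for the density on it.\<close>

lemma gaussian_prob_ge:
  assumes S: "S \<in> sets borel" and s: "s \<ge> 0" and sub: "ball c s \<subseteq> S" and R: "\<And>z. z \<in> ball c s \<Longrightarrow> cmod z \<le> R"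
  shows "s\<^sup>2 * exp (- R\<^sup>2) \<le> prob {\<omega> \<in> space M. \<phi> n \<omega> \<in> S}"
proof -
  have "ennreal (s\<^sup>2 * exp (- R\<^sup>2)) = ennreal (exp (- R\<^sup>2) / pi) * ennreal (pi * s\<^sup>2)"
    by (subst ennreal_mult[symmetric]) auto
  also have "\<dots> = (\<integral>\<^sup>+z. ennreal (exp (- R\<^sup>2) / pi) * indicator (ball c s) z \<partial>lborel)"
    using s by (subst nn_integral_cmult_indicator) (auto simp: emeasure_lborel_complex_ball)
  also have "\<dots> \<le> (\<integral>\<^sup>+z. ennreal (exp (- (cmod z)\<^sup>2) / pi) * indicator S z \<partial>lborel)"
  proof (rule nn_integral_mono)
    fix z :: complex
    have "exp (- R\<^sup>2) \<le> exp (- (cmod z)\<^sup>2)" if "z \<in> ball c s"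
      using power_mono[OF R[OF that] norm_ge_zero, of 2] by simp
    then show "ennreal (exp (- R\<^sup>2) / pi) * indicator (ball c s) z \<le> ennreal (exp (- (cmod z)\<^sup>2) / pi) * indicator S z"
      using sub by (auto split: split_indicator intro!: ennreal_leI divide_right_mono)
  qed
  also have "\<dots> = ennreal (prob {\<omega> \<in> space M. \<phi> n \<omega> \<in> S})"
    by (rule emeasure_gaussian[symmetric]) fact
  finally show ?thesis by (subst (asm) ennreal_le_iff) auto
qed

text \<open>Since \<open>(n + 1)^2 \<ge> n + 1\<close>, linearly growing thresholds make the tails
  geometric in \<open>n\<close>. The condition \<open>A \<ge> 2\<close> brings the ratio below 1/2,
  so the series costs at most a factor 2.\<close>

lemma prob_exceeds_linear:
  assumes A: "A \<ge> 2"
  shows "prob {\<omega> \<in> space M. \<exists>n. cmod (\<phi> n \<omega>) > A * real (n + 1)} \<le> 4 * exp (- A\<^sup>2 / 2)"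
proof -
  define q where "q = exp (- A\<^sup>2 / 2)"
  have "q \<le> exp (- 1)" using power_mono[OF A, of 2] by (simp add: q_def)
  also have "\<dots> \<le> 1 / 2" using exp_ge_add_one_self[of 1] by (simp add: exp_minus field_simps)
  finally have q: "0 < q" "q \<le> 1 / 2" by (auto simp: q_def)
  have le: "prob {\<omega> \<in> space M. cmod (\<phi> n \<omega>) > A * real (n + 1)} \<le> 2 * q * q ^ n" for n
  proof -
    have "prob {\<omega> \<in> space M. cmod (\<phi> n \<omega>) > A * real (n + 1)} \<le> 2 * exp (- (A * real (n + 1))\<^sup>2 / 2)"
      using A by (intro gaussian_tail) auto
    also have "\<dots> \<le> 2 * exp (real (n + 1) * (- A\<^sup>2 / 2))"
    proof -
      have "A\<^sup>2 * real (n + 1) \<le> A\<^sup>2 * (real (n + 1))\<^sup>2"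
        by (intro mult_left_mono self_le_power) auto
      then show ?thesis by (simp add: power_mult_distrib mult_ac)
    qed
    also have "\<dots> = 2 * q * q ^ n"
      unfolding exp_of_nat_mult q_def by simp
    finally show ?thesis .
  qed
  have gs: "(\<lambda>n. 2 * q * q ^ n) sums (2 * q * (1 / (1 - q)))"
    using q by (intro sums_mult geometric_sums) auto
  have "prob {\<omega> \<in> space M. \<exists>n. cmod (\<phi> n \<omega>) > A * real (n + 1)} = prob (\<Union>n. {\<omega> \<in> space M. cmod (\<phi> n \<omega>) > A * real (n + 1)})"
    by (intro arg_cong[where f = prob]) auto
  also have "\<dots> \<le> (\<Sum>n. prob {\<omega> \<in> space M. cmod (\<phi> n \<omega>) > A * real (n + 1)})"
    by (intro finite_measure_subadditive_countably summable_comparison_test'[OF sums_summable[OF gs]])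
       (use le in auto)
  also have "\<dots> \<le> (\<Sum>n. 2 * q * q ^ n)"
    by (intro suminf_le le summable_comparison_test'[OF sums_summable[OF gs]] sums_summable[OF gs])
       (use le in auto)
  also have "\<dots> = 2 * q * (1 / (1 - q))" using gs by (simp add: sums_iff)
  also have "\<dots> \<le> 2 * q * 2" using q by (intro mult_left_mono) (auto simp: field_simps)
  finally show ?thesis by (simp add: q_def)
qed

text \<open>Independence gives the finite products; continuity from above along the decreasing
  events passes to all indices.\<close>

lemma prob_all_ge:
  assumes S: "\<And>n. S n \<in> sets borel"
    and le: "\<And>m. c \<le> (\<Prod>n<m. prob {\<omega> \<in> space M. \<phi> n \<omega> \<in> S n})"
  shows "c \<le> prob {\<omega> \<in> space M. \<forall>n. \<phi> n \<omega> \<in> S n}"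
proof -
  note S[measurable]
  define B where "B = (\<lambda>m. {\<omega> \<in> space M. \<forall>n<m. \<phi> n \<omega> \<in> S n})"
  have "prob (B m) = (\<Prod>n<m. prob {\<omega> \<in> space M. \<phi> n \<omega> \<in> S n})" for m
  proof (cases "m = 0")
    case False
    then have "prob (\<Inter>n\<in>{..<m}. \<phi> n -` S n \<inter> space M) = (\<Prod>n<m. prob (\<phi> n -` S n \<inter> space M))"
      using S by (intro indep_varsD[OF indep]) auto
    also have "(\<Inter>n\<in>{..<m}. \<phi> n -` S n \<inter> space M) = B m" using False by (auto simp: B_def)
    also have "(\<lambda>n. \<phi> n -` S n \<inter> space M) = (\<lambda>n. {\<omega> \<in> space M. \<phi> n \<omega> \<in> S n})" by auto
    finally show ?thesis .
  qed (auto simp: B_def prob_space)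
  then have cB: "c \<le> prob (B m)" for m using le by simp
  have "(\<lambda>m. prob (B m)) \<longlonglongrightarrow> prob (\<Inter>m. B m)"
    by (intro finite_Lim_measure_decseq) (auto simp: B_def decseq_def)
  then have "c \<le> prob (\<Inter>m. B m)"
    by (rule LIMSEQ_le_const) (use cB in auto)
  also have "(\<Inter>m. B m) = {\<omega> \<in> space M. \<forall>n. \<phi> n \<omega> \<in> S n}"
    by (auto simp: B_def)
  finally show ?thesis .
qed

text \<open>The tail coefficients are independent of the first \<open>N\<close>, so they can be
  frozen. Each \<open>T j\<close> is then a constant, which translation invariance removes from the
  integral of \<open>h j\<close>; the bound is uniform in the tail and survives integration over
  it.\<close>

lemma nn_integral_prod_polynomial_values_le:
  fixes z a :: "nat \<Rightarrow> complex" and h :: "nat \<Rightarrow> complex \<Rightarrow> ennreal" and T :: "nat \<Rightarrow> (nat \<Rightarrow> complex) \<Rightarrow> complex"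
  assumes N: "N > 0" and inj: "inj_on z {..<N}" and a: "\<And>j. j < N \<Longrightarrow> a j \<noteq> 0"
    and h: "\<And>j. h j \<in> borel_measurable borel"
    and T: "\<And>j. T j \<in> borel_measurable (PiM {N..} (\<lambda>_. borel))"
  shows "(\<integral>\<^sup>+\<omega>. (\<Prod>j<N. h j ((\<Sum>n<N. \<phi> n \<omega> * (a n * z j ^ n)) + T j (\<lambda>n\<in>{N..}. \<phi> n \<omega>))) \<partial>M)
     \<le> ennreal (1 / pi) ^ N * (\<Prod>j<N. ennreal (1 / ((cmod (a j))\<^sup>2 * (\<Prod>i<j. (cmod (z j - z i))\<^sup>2))) * (\<integral>\<^sup>+w. h j w \<partial>lborel))"
    (is "_ \<le> ?R")
proof -
  note h[measurable] T[measurable]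
  let ?S = "PiM {..<N} (\<lambda>_. borel) :: (nat \<Rightarrow> complex) measure"
  let ?T = "PiM {N..} (\<lambda>_. borel) :: (nat \<Rightarrow> complex) measure"
  let ?X = "\<lambda>\<omega>. \<lambda>n\<in>{..<N}. \<phi> n \<omega>" and ?Y = "\<lambda>\<omega>. \<lambda>n\<in>{N..}. \<phi> n \<omega>"
  define F where "F = (\<lambda>(x, y). \<Prod>j<N. h j ((\<Sum>n<N. x n * (a n * z j ^ n)) + T j y))"
  have [measurable]: "?X \<in> measurable M ?S" "?Y \<in> measurable M ?T" by measurable
  have [measurable]: "F \<in> borel_measurable (?S \<Otimes>\<^sub>M ?T)"
    unfolding F_def by measurable
  have "indep_var ?S ?X ?T ?Y"
    by (rule indep_var_restrict[OF indep]) auto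
  then have joint: "distr M (?S \<Otimes>\<^sub>M ?T) (\<lambda>\<omega>. (?X \<omega>, ?Y \<omega>)) = distr M ?S ?X \<Otimes>\<^sub>M distr M ?T ?Y"
    unfolding indep_var_distribution_eq by simp
  interpret X: prob_space "distr M ?S ?X" by (rule prob_space_distr) measurable
  interpret Y: prob_space "distr M ?T ?Y" by (rule prob_space_distr) measurable
  interpret XY: pair_sigma_finite "distr M ?S ?X" "distr M ?T ?Y" ..
  let ?\<nu> = "\<lambda>n. distr M borel (\<phi> n)"
  have distrX: "distr M ?S ?X = PiM {..<N} ?\<nu>"
    by (rule indep_vars_iff_distr_eq_PiM'[THEN iffD1]) (use N in \<open>auto intro: indep_vars_subset[OF indep]\<close>)
  have psf: "product_sigma_finite ?\<nu>"
    by (intro product_sigma_finite.intro prob_space_imp_sigma_finite prob_space_distr) auto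
  have dle: "(\<integral>\<^sup>+x. f x \<partial>?\<nu> i) \<le> ennreal (1 / pi) * (\<integral>\<^sup>+x. f x \<partial>lborel)"
    if [measurable]: "f \<in> borel_measurable borel" for f i
  proof -
    have "(\<integral>\<^sup>+x. f x \<partial>?\<nu> i) = (\<integral>\<^sup>+z. ennreal (exp (- (cmod z)\<^sup>2) / pi) * f z \<partial>lborel)"
      by (subst nn_integral_distr) (auto simp: nn_integral_gaussian)
    also have "\<dots> \<le> (\<integral>\<^sup>+z. ennreal (1 / pi) * f z \<partial>lborel)"
      by (intro nn_integral_mono mult_right_mono ennreal_leI divide_right_mono) auto
    also have "\<dots> = ennreal (1 / pi) * (\<integral>\<^sup>+x. f x \<partial>lborel)"
      by (rule nn_integral_cmult) auto
    finally show ?thesis .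
  qed
  have inner: "(\<integral>\<^sup>+x. F (x, y) \<partial>distr M ?S ?X) \<le> ?R" if y: "y \<in> space ?T" for y
  proof -
    have "(\<lambda>x. F (x, y)) \<in> borel_measurable ?S" using y by measurable
    moreover have "sets (PiM {..<N} (\<lambda>_. lborel)) = sets ?S" by (intro sets_PiM_cong) auto
    ultimately have m: "(\<lambda>x. F (x, y)) \<in> borel_measurable (PiM {..<N} (\<lambda>_. lborel))"
      by (simp cong: measurable_cong_sets)
    have "(\<integral>\<^sup>+x. F (x, y) \<partial>distr M ?S ?X) \<le> ennreal (1 / pi) ^ card {..<N} * (\<integral>\<^sup>+x. F (x, y) \<partial>PiM {..<N} (\<lambda>_. lborel))"
      unfolding distrX by (rule nn_integral_PiM_le_lborel[OF psf _ dle _ m]) auto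
    also have "(\<integral>\<^sup>+x. F (x, y) \<partial>PiM {..<N} (\<lambda>_. lborel)) =
      (\<Prod>j<N. ennreal (1 / ((cmod (a j))\<^sup>2 * (\<Prod>i<j. (cmod (z j - z i))\<^sup>2))) * (\<integral>\<^sup>+w. h j (w + T j y) \<partial>lborel))"
      unfolding F_def prod.case
      by (rule nn_integral_polynomial_values[OF inj a, where h = "\<lambda>j w. h j (w + T j y)"]) auto
    also have "(\<lambda>j. \<integral>\<^sup>+w. h j (w + T j y) \<partial>lborel) = (\<lambda>j. \<integral>\<^sup>+w. h j w \<partial>lborel)"
      by (intro ext) (subst nn_integral_lborel_translate[of _ "T _ y", symmetric], auto simp: add.commute)
    finally show ?thesis by (simp only: card_lessThan)
  qed
  have "(\<integral>\<^sup>+\<omega>. F (?X \<omega>, ?Y \<omega>) \<partial>M) = (\<integral>\<^sup>+p. F p \<partial>distr M (?S \<Otimes>\<^sub>M ?T) (\<lambda>\<omega>. (?X \<omega>, ?Y \<omega>)))"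
    by (rule nn_integral_distr[symmetric]) measurable
  also have "\<dots> = (\<integral>\<^sup>+y. (\<integral>\<^sup>+x. F (x, y) \<partial>distr M ?S ?X) \<partial>distr M ?T ?Y)"
    unfolding joint by (rule XY.nn_integral_snd[symmetric]) measurable
  also have "\<dots> \<le> (\<integral>\<^sup>+y. ?R \<partial>distr M ?T ?Y)"
    by (intro nn_integral_mono inner) simp
  also have "\<dots> = ?R" using Y.emeasure_space_1 by simp
  finally show ?thesis by (simp add: F_def)
qed

end

section \<open>The Gaussian entire function and the hole event\<close>

lemma gef_term_le:
  assumes c: "\<And>n. cmod (\<phi> n \<omega>) \<le> A * real (n + 1)" and z: "cmod z \<le> r"
  shows "cmod (\<phi> n \<omega> * z ^ n / complex_of_real (sqrt (fact n))) \<le> A * exp (2 * r\<^sup>2) * (real (Suc n) * (1 / 2) ^ n)"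
proof -
  have r: "r \<ge> 0" using z norm_ge_zero order_trans by blast
  have A: "0 \<le> A * real (n + 1)" using c[of n] norm_ge_zero order_trans by blast
  have "cmod (\<phi> n \<omega> * z ^ n / complex_of_real (sqrt (fact n))) = cmod (\<phi> n \<omega>) * (cmod z ^ n / sqrt (fact n))"
    by (simp add: norm_mult norm_divide norm_power)
  also have "\<dots> \<le> (A * real (n + 1)) * (r ^ n / sqrt (fact n))"
    using z A by (intro mult_mono c divide_right_mono power_mono) auto
  also have "\<dots> \<le> (A * real (n + 1)) * (exp (2\<^sup>2 * r\<^sup>2 / 2) * (1 / 2) ^ n)"
    using r by (intro mult_left_mono power_div_sqrt_fact_le A) auto
  finally show ?thesis by (simp add: mult_ac)
qed

lemma sums_Suc_half_power: "(\<lambda>n. C * (real (Suc n) * (1 / 2) ^ n)) sums (C * 4)"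
  using sums_mult[OF geometric_deriv_sums[of "1 / 2 :: real"], of C] by (simp add: power2_eq_square)

lemma summable_gef:
  assumes c: "\<And>n. cmod (\<phi> n \<omega>) \<le> A * real (n + 1)"
  shows "summable (\<lambda>n. \<phi> n \<omega> * z ^ n / complex_of_real (sqrt (fact n)))"
  by (rule summable_comparison_test'[OF sums_summable[OF sums_Suc_half_power]])
     (rule gef_term_le[of \<phi> \<omega> A z "cmod z", OF c order_refl])

text \<open>The ratio 1/2 in the term bound produces \<open>exp (2 * r^2)\<close>, and 4 is the sum
  of \<open>(n + 1) / 2^n\<close>. The exponent is not sharp, but only its order \<open>r^2\<close>
  matters, since it is later multiplied by an exponentially small error.\<close>

lemma cmod_gef_le:
  assumes c: "\<And>n. cmod (\<phi> n \<omega>) \<le> A * real (n + 1)" and z: "cmod z \<le> r"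
  shows "cmod (gef \<phi> \<omega> z) \<le> 4 * A * exp (2 * r\<^sup>2)"
proof -
  have "cmod (gef \<phi> \<omega> z) \<le> (\<Sum>n. A * exp (2 * r\<^sup>2) * (real (Suc n) * (1 / 2) ^ n))"
    unfolding gef_def
    by (rule norm_suminf_le[OF gef_term_le[of \<phi> \<omega> A z r, OF c z] sums_summable[OF sums_Suc_half_power]])
  also have "\<dots> = 4 * A * exp (2 * r\<^sup>2)"
    using sums_Suc_half_power[of "A * exp (2 * r\<^sup>2)"] by (simp only: sums_iff)
  finally show ?thesis .
qed

lemma holomorphic_gef:
  assumes c: "\<And>n. cmod (\<phi> n \<omega>) \<le> A * real (n + 1)"
  shows "gef \<phi> \<omega> holomorphic_on S"
proof -
  define a where "a = (\<lambda>n. \<phi> n \<omega> / complex_of_real (sqrt (fact n)))"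
  have "summable (\<lambda>n. a n * y ^ n)" for y
    using summable_gef[of \<phi> \<omega> A y, OF c] by (simp add: a_def)
  then have "((\<lambda>z. \<Sum>n. a n * z ^ n) has_field_derivative (\<Sum>n. diffs a n * z ^ n)) (at z)" for z
    by (rule termdiffs_strong_converges_everywhere)
  moreover have "gef \<phi> \<omega> = (\<lambda>z. \<Sum>n. a n * z ^ n)"
    by (simp add: gef_def a_def fun_eq_iff)
  ultimately have "gef \<phi> \<omega> field_differentiable (at z)" for z
    by (auto simp: field_differentiable_def)
  then show ?thesis
    by (auto simp: holomorphic_on_def intro: field_differentiable_at_within)
qed

lemma gef_0: "gef \<phi> \<omega> 0 = \<phi> 0 \<omega>"
proof -
  have "(\<lambda>n. \<phi> n \<omega> * 0 ^ n / complex_of_real (sqrt (fact n))) = (\<lambda>n. if n = 0 then \<phi> 0 \<omega> else 0)"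
    by (auto simp: fun_eq_iff)
  then show ?thesis unfolding gef_def using sums_single[of 0 "\<lambda>_. \<phi> 0 \<omega>"] by (simp add: sums_iff)
qed

text \<open>The value at 0 is \<open>\<phi> 0\<close>, of modulus at most \<open>A\<close>; a small
  value only lowers the sum. The condition \<open>e \<le> 1\<close> keeps the weight
  \<open>1 - e\<close> nonnegative, and \<open>e * B \<le> 1\<close> absorbs the discretisation
  error.\<close>

lemma sum_ln_cmod_gef_le:
  assumes c: "\<And>n. cmod (\<phi> n \<omega>) \<le> A * real (n + 1)" and A: "A \<ge> 1"
    and nz: "\<And>z. cmod z \<le> r \<Longrightarrow> gef \<phi> \<omega> z \<noteq> 0"
    and r: "2 < r" and N: "0 < N" and B: "4 * A * exp (2 * r\<^sup>2) < exp B"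
  defines "e \<equiv> 2 * r * (r - 1) * ((r - 2) / (r - 1)) ^ N"
  assumes e: "e \<le> 1" "e * B \<le> 1"
  shows "(\<Sum>j<N. ln (cmod (gef \<phi> \<omega> (of_real (r - 2) * cis (2 * pi * real j / real N))))) \<le> real N * (1 + ln A)"
proof -
  have "(\<Sum>j<N. ln (cmod (gef \<phi> \<omega> (of_real (r - 2) * cis (2 * pi * real j / real N)))))
    \<le> real N * (e * B + (1 - e) * ln (cmod (gef \<phi> \<omega> 0)))"
    unfolding e_def
  proof (intro sum_ln_cmod_at_roots_of_unity holomorphic_gef)
    show "cmod (\<phi> n \<omega>) \<le> A * real (n + 1)" for n by (rule c)
    show "cmod (gef \<phi> \<omega> z) < exp B" if "cmod z < r" for z
      using cmod_gef_le[of \<phi> \<omega> A z r, OF c] that B by simp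
  qed (use nz r N in auto)
  also have "\<dots> \<le> real N * (1 + ln A)"
  proof (rule mult_left_mono[OF add_mono])
    have "cmod (gef \<phi> \<omega> 0) \<le> A" using c[of 0] by (simp add: gef_0)
    moreover have "cmod (gef \<phi> \<omega> 0) > 0" using nz[of 0] r by simp
    ultimately have "ln (cmod (gef \<phi> \<omega> 0)) \<le> ln A"
      by (intro ln_mono) auto
    moreover have "0 \<le> e" using r by (simp add: e_def)
    ultimately have "(1 - e) * ln (cmod (gef \<phi> \<omega> 0)) \<le> (1 - e) * ln A"
      using e by (intro mult_left_mono) auto
    also have "\<dots> \<le> 1 * ln A" using A \<open>0 \<le> e\<close> by (intro mult_right_mono) auto
    finally show "(1 - e) * ln (cmod (gef \<phi> \<omega> 0)) \<le> ln A" by simp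
  qed (use e in auto)
  finally show ?thesis .
qed

context complex_gaussian_sequence
begin

lemma measurable_gef [measurable]: "(\<lambda>\<omega>. gef \<phi> \<omega> z) \<in> borel_measurable M"
  unfolding gef_def by measurable

text \<open>For every integer \<open>A\<close> this event lies in the exceedance event with factor
  \<open>A\<close>, whose probability tends to 0.\<close>

lemma not_linear_growth_null:
  "{\<omega> \<in> space M. \<not> (\<exists>A::nat. \<forall>n. cmod (\<phi> n \<omega>) \<le> real A * real (n + 1))} \<in> null_sets M" (is "?B \<in> _")
proof (rule null_setsI)
  show "?B \<in> events" by measurable
  have "prob ?B \<le> 4 * exp (- (real A)\<^sup>2 / 2)" if "A \<ge> 2" for A :: nat
  proof -
    have "prob ?B \<le> prob {\<omega> \<in> space M. \<exists>n. cmod (\<phi> n \<omega>) > real A * real (n + 1)}"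
      by (intro finite_measure_mono) (auto simp: not_le)
    also have "\<dots> \<le> 4 * exp (- (real A)\<^sup>2 / 2)" using that by (intro prob_exceeds_linear) auto
    finally show ?thesis .
  qed
  moreover have "(\<lambda>A::nat. 4 * exp (- (real A)\<^sup>2 / 2)) \<longlonglongrightarrow> 0" by real_asymp
  ultimately have "prob ?B \<le> 0"
    by (intro LIMSEQ_le_const[where X = "\<lambda>A::nat. 4 * exp (- (real A)\<^sup>2 / 2)"]) blast+
  then have "prob ?B = 0" by (simp add: measure_le_0_iff)
  then show "emeasure M ?B = 0" by (simp only: emeasure_eq_measure ennreal_0)
qed

text \<open>Under linear growth of the coefficients the function is continuous, so by compactness it
  has no zero in the closed disc iff it is bounded away from 0 on a countable dense subset. What
  remains of the event lies in a null set.\<close>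

lemma hole_event_measurable:
  assumes r: "r \<ge> 0"
  shows "{\<omega> \<in> space M. \<forall>z. cmod z \<le> r \<longrightarrow> gef \<phi> \<omega> z \<noteq> 0} \<in> sets (completion M)" (is "?H \<in> _")
proof -
  obtain D where D: "countable D" "D \<subseteq> cball (0::complex) r" "cball 0 r \<subseteq> closure D"
    using separable by blast
  define G where "G = {\<omega> \<in> space M. \<exists>A::nat. \<forall>n. cmod (\<phi> n \<omega>) \<le> real A * real (n + 1)}"
  have G: "G \<in> sets M" unfolding G_def by measurable
  define K where "K = {\<omega> \<in> space M. \<exists>k::nat. \<forall>z\<in>D. 1 / real (Suc k) \<le> cmod (gef \<phi> \<omega> z)}"
  have K: "K \<in> sets M" unfolding K_def using D(1) by measurable
  have "?H \<inter> G = K \<inter> G"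
  proof (intro set_eqI iffI)
    fix \<omega> assume w: "\<omega> \<in> ?H \<inter> G"
    then obtain A :: nat where A: "\<And>n. cmod (\<phi> n \<omega>) \<le> real A * real (n + 1)" by (auto simp: G_def)
    have "continuous_on (cball 0 r) (\<lambda>z. cmod (gef \<phi> \<omega> z))"
      by (intro continuous_intros holomorphic_on_imp_continuous_on holomorphic_gef[of _ _ "real A"] A)
    from continuous_attains_inf[OF _ _ this] r obtain x where x: "x \<in> cball 0 r"
      "\<And>y. y \<in> cball 0 r \<Longrightarrow> cmod (gef \<phi> \<omega> x) \<le> cmod (gef \<phi> \<omega> y)" by force
    then have "cmod (gef \<phi> \<omega> x) > 0" using w by auto
    then obtain k where k: "1 / real (Suc k) < cmod (gef \<phi> \<omega> x)" using nat_approx_posE by blast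
    then have "1 / real (Suc k) \<le> cmod (gef \<phi> \<omega> z)" if "z \<in> D" for z
      using x(2)[of z] D(2) that by force
    then show "\<omega> \<in> K \<inter> G" using w by (auto simp: K_def)
  next
    fix \<omega> assume w: "\<omega> \<in> K \<inter> G"
    then obtain A :: nat where A: "\<And>n. cmod (\<phi> n \<omega>) \<le> real A * real (n + 1)" by (auto simp: G_def)
    from w obtain k where k: "\<And>z. z \<in> D \<Longrightarrow> 1 / real (Suc k) \<le> cmod (gef \<phi> \<omega> z)" by (auto simp: K_def)
    have "closed {z. 1 / real (Suc k) \<le> cmod (gef \<phi> \<omega> z)}"
      by (intro closed_Collect_le continuous_intros holomorphic_on_imp_continuous_on holomorphic_gef[of _ _ "real A"] A)
    then have "closure D \<subseteq> {z. 1 / real (Suc k) \<le> cmod (gef \<phi> \<omega> z)}"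
      by (intro closure_minimal) (use k in auto)
    then have le: "1 / real (Suc k) \<le> cmod (gef \<phi> \<omega> z)" if "cmod z \<le> r" for z
      using that D(3) by auto
    have "gef \<phi> \<omega> z \<noteq> 0" if "cmod z \<le> r" for z
    proof
      assume "gef \<phi> \<omega> z = 0"
      then have "1 / real (Suc k) \<le> 0" using le[OF that] by simp
      then show False by (simp add: divide_le_0_iff)
    qed
    then show "\<omega> \<in> ?H \<inter> G" using w by (auto simp: G_def)
  qed
  then have "?H \<inter> G \<in> sets (completion M)" using K G by auto
  moreover have "?H - G \<in> sets (completion M)"
    by (rule null_sets_completion[OF not_linear_growth_null]) (auto simp: G_def)
  ultimately have "(?H \<inter> G) \<union> (?H - G) \<in> sets (completion M)" by (intro sets.Un) auto
  then show ?thesis by (simp add: Un_Diff_Int Int_Diff_Un)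
qed

lemma hole_prob_le:
  assumes r: "r \<ge> 0" and X: "X \<in> sets M" and sub: "{\<omega> \<in> space M. \<forall>z. cmod z \<le> r \<longrightarrow> gef \<phi> \<omega> z \<noteq> 0} \<subseteq> X"
  shows "hole_prob M \<phi> r \<le> prob X"
proof -
  interpret C: prob_space "completion M" by (rule prob_space_completion)
  have "hole_prob M \<phi> r \<le> measure (completion M) X"
    unfolding hole_prob_def by (intro C.finite_measure_mono sub sets_completionI_sets X)
  then show ?thesis using X by simp
qed

text \<open>This direction rests on measurability of the hole event, since a non-measurable set
  would have measure 0 by convention.\<close>

lemma hole_prob_ge:
  assumes r: "r \<ge> 0" and X: "X \<in> sets M" and sub: "X \<subseteq> {\<omega> \<in> space M. \<forall>z. cmod z \<le> r \<longrightarrow> gef \<phi> \<omega> z \<noteq> 0}"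
  shows "prob X \<le> hole_prob M \<phi> r"
proof -
  interpret C: prob_space "completion M" by (rule prob_space_completion)
  have "measure (completion M) X \<le> hole_prob M \<phi> r"
    unfolding hole_prob_def by (intro C.finite_measure_mono sub hole_event_measurable r)
  then show ?thesis using X by simp
qed

end

section \<open>Upper bound for the hole probability\<close>

text \<open>The exponent \<open>2 - 2 / B\<close> is just below the critical value 2 in the plane, so that the
  integral over the disc of radius \<open>exp B\<close> is only of order \<open>B\<close>. It is estimated
  over the shells between consecutive radii \<open>exp (B - k)\<close>.\<close>

lemma nn_integral_norm_power_le:
  assumes B: "B \<ge> 2" and t: "t \<ge> 0"
  defines "h \<equiv> \<lambda>w::complex. if w \<noteq> 0 \<and> cmod w \<le> exp B then ennreal (exp ((2 - 2 / B) * (t - ln (cmod w)))) else 0"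
  shows "(\<integral>\<^sup>+w. h w \<partial>lborel) \<le> ennreal (pi * (exp (2 * t + 4) * B))"
proof -
  define \<alpha> where "\<alpha> = 2 - 2 / B"
  have \<alpha>: "0 \<le> \<alpha>" "\<alpha> \<le> 2" using B by (auto simp: \<alpha>_def field_simps)
  define c where "c = (\<lambda>k::nat. exp (\<alpha> * (t + real k + 1 - B)))"
  define D where "D = (\<lambda>k::nat. cball (0::complex) (exp (B - real k)))"
  have D[measurable]: "D k \<in> sets borel" for k unfolding D_def by (intro borel_closed) simp
  have "h w \<le> (\<Sum>k. ennreal (c k) * indicator (D k) w)" for w
  proof (cases "w \<noteq> 0 \<and> cmod w \<le> exp B")
    case True
    define y where "y = B - ln (cmod w)"
    have "ln (cmod w) \<le> B" using True by (metis ln_exp ln_mono zero_less_norm_iff)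
    then have y: "y \<ge> 0" by (simp add: y_def)
    define k where "k = nat \<lfloor>y\<rfloor>"
    have k: "real k \<le> y" "y < real k + 1" using y by (auto simp: k_def)
    have "ln (cmod w) \<le> B - real k" using k by (simp add: y_def)
    then have "cmod w \<le> exp (B - real k)" using True by (metis exp_le_cancel_iff exp_ln zero_less_norm_iff)
    then have wD: "w \<in> D k" by (simp add: D_def)
    have "h w = ennreal (exp (\<alpha> * (t - ln (cmod w))))" using True by (simp add: h_def \<alpha>_def)
    also have "\<dots> \<le> ennreal (c k)"
      unfolding c_def using k \<alpha> by (intro ennreal_leI) (auto simp: y_def intro!: mult_left_mono)
    also have "\<dots> = (\<Sum>k\<in>{k}. ennreal (c k) * indicator (D k) w)" using wD by simp
    also have "\<dots> \<le> (\<Sum>k. ennreal (c k) * indicator (D k) w)"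
      by (intro sum_le_suminf) auto
    finally show ?thesis .
  qed (auto simp: h_def)
  then have "(\<integral>\<^sup>+w. h w \<partial>lborel) \<le> (\<integral>\<^sup>+w. (\<Sum>k. ennreal (c k) * indicator (D k) w) \<partial>lborel)"
    by (intro nn_integral_mono)
  also have "\<dots> = (\<Sum>k. \<integral>\<^sup>+w. ennreal (c k) * indicator (D k) w \<partial>lborel)"
    by (intro nn_integral_suminf) measurable
  also have "\<dots> = (\<Sum>k. ennreal (pi * exp (\<alpha> * t + \<alpha> + 2) * exp (- 2 / B) ^ k))"
  proof (intro suminf_cong)
    fix k
    have "(\<integral>\<^sup>+w. ennreal (c k) * indicator (D k) w \<partial>lborel) = ennreal (c k) * emeasure lborel (D k)"
      by (intro nn_integral_cmult_indicator) (auto simp: D_def)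
    also have "emeasure lborel (D k) = ennreal (pi * (exp (B - real k))\<^sup>2)"
      using emeasure_cball[of "exp (B - real k)" "0::complex"] by (simp add: D_def unit_ball_vol_2)
    also have "ennreal (c k) * ennreal (pi * (exp (B - real k))\<^sup>2) = ennreal (c k * (pi * (exp (B - real k))\<^sup>2))"
      by (simp add: ennreal_mult c_def)
    also have "c k * (pi * (exp (B - real k))\<^sup>2) = pi * exp (\<alpha> * (t + real k + 1 - B) + 2 * (B - real k))"
      by (simp only: c_def exp_add exp_double[of "B - real k"] mult_ac)
    \<comment> \<open>The choice of \<open>\<alpha>\<close> gives
      \<open>(2 - \<alpha>) * B = 2\<close>: the factor of order \<open>exp (2 * B)\<close> cancels,
      and each further shell gains \<open>exp (- 2 / B)\<close>.\<close>
    also have "\<alpha> * (t + real k + 1 - B) + 2 * (B - real k) = \<alpha> * t + \<alpha> + 2 + real k * (- 2 / B)"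
      using B by (simp add: \<alpha>_def field_simps)
    also have "pi * exp \<dots> = pi * exp (\<alpha> * t + \<alpha> + 2) * exp (- 2 / B) ^ k"
      by (simp only: exp_add[of "\<alpha> * t + \<alpha> + 2"] exp_of_nat_mult mult.assoc)
    finally show "(\<integral>\<^sup>+w. ennreal (c k) * indicator (D k) w \<partial>lborel) = ennreal (pi * exp (\<alpha> * t + \<alpha> + 2) * exp (- 2 / B) ^ k)" .
  qed
  also have "\<dots> = ennreal (pi * exp (\<alpha> * t + \<alpha> + 2) * (1 / (1 - exp (- 2 / B))))"
    using B by (intro suminf_ennreal_eq sums_mult geometric_sums) auto
  also have "\<dots> \<le> ennreal (pi * (exp (2 * t + 4) * B))"
  proof (rule ennreal_leI)
    \<comment> \<open>The geometric series sums to at most \<open>B\<close>;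
      \<open>B \<ge> 2\<close> is what makes \<open>1 / (1 + 2 / B) \<le> 1 - 1 / B\<close>.\<close>
    have "exp (- 2 / B) = 1 / exp (2 / B)" by (simp add: exp_minus inverse_eq_divide)
    also have "\<dots> \<le> 1 / (1 + 2 / B)"
      using B by (intro frac_le exp_ge_add_one_self) (auto intro: add_pos_nonneg)
    also have "1 / (1 + 2 / B) \<le> 1 - 1 / B" using B by (simp add: field_simps)
    finally have "1 / B \<le> 1 - exp (- 2 / B)" by simp
    then have "1 / (1 - exp (- 2 / B)) \<le> 1 / (1 / B)"
      using B by (intro divide_left_mono) (auto intro!: mult_pos_pos)
    moreover have "exp (\<alpha> * t + \<alpha> + 2) \<le> exp (2 * t + 4)"
      using \<alpha> t mult_right_mono[of \<alpha> 2 t] by simp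
    ultimately have le: "exp (\<alpha> * t + \<alpha> + 2) * (1 / (1 - exp (- 2 / B))) \<le> exp (2 * t + 4) * B"
      using B by (intro mult_mono) auto
    show "pi * exp (\<alpha> * t + \<alpha> + 2) * (1 / (1 - exp (- 2 / B))) \<le> pi * (exp (2 * t + 4) * B)"
      unfolding mult.assoc[of pi] by (rule mult_left_mono[OF le]) simp
  qed
  finally show ?thesis .
qed

lemma inj_on_scaled_roots_of_unity:
  assumes "\<rho> > 0"
  shows "inj_on (\<lambda>j. of_real \<rho> * cis (2 * pi * real j / real N)) {..<N}"
proof (cases "N = 0")
  case False
  then have "inj_on (\<lambda>k. cis (2 * pi * real k / real N)) {..<N}"
    using Complex.bij_betw_roots_unity[of N] by (auto simp: bij_betw_def)
  then show ?thesis using assms by (auto simp: inj_on_def)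
qed simp

text \<open>Node \<open>j\<close> forms \<open>j\<close> pairs with earlier nodes, each scaling by
  \<open>\<rho>^2\<close>. The discriminant of the unscaled roots is \<open>N^N\<close>, of which
  only the bound 1 is kept: its logarithm is \<open>O(r^2 ln r)\<close>.\<close>

lemma prod_diff_scaled_roots_of_unity_ge:
  fixes N :: nat
  assumes \<rho>: "\<rho> > 0"
  defines "z \<equiv> \<lambda>j. of_real \<rho> * cis (2 * pi * real j / real N)"
  shows "(\<Prod>j<N. \<rho> ^ (2 * j)) \<le> (\<Prod>j<N. \<Prod>i<j. (cmod (z j - z i))\<^sup>2)"
proof -
  define w where "w = (\<lambda>j. cis (2 * pi * real j / real N))"
  have zw: "(cmod (z j - z i))\<^sup>2 = \<rho>\<^sup>2 * (cmod (w j - w i))\<^sup>2" for i j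
    using \<rho> by (simp add: z_def w_def norm_mult power_mult_distrib flip: right_diff_distrib)
  have "(\<Prod>j<N. \<Prod>i<j. (cmod (w j - w i))\<^sup>2) = (\<Prod>j<N. \<Prod>i\<in>{..<N} - {j}. cmod (w j - w i))"
    by (rule prod_lessThan_square_symmetric) (rule norm_minus_commute)
  also have "\<dots> = (\<Prod>j<N. real N)"
    by (intro prod.cong refl) (simp add: w_def prod_diff_roots_of_unity)
  also have "\<dots> \<ge> 1" by (intro prod_ge_1) auto
  finally have ge: "1 \<le> (\<Prod>j<N. \<Prod>i<j. (cmod (w j - w i))\<^sup>2)" .
  have "(\<Prod>j<N. \<rho> ^ (2 * j)) \<le> (\<Prod>j<N. \<rho> ^ (2 * j)) * (\<Prod>j<N. \<Prod>i<j. (cmod (w j - w i))\<^sup>2)"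
    using mult_left_mono[OF ge, of "\<Prod>j<N. \<rho> ^ (2 * j)"] \<rho> by (simp only: mult_1_right) (simp add: prod_nonneg)
  also have "\<dots> = (\<Prod>j<N. \<Prod>i<j. (cmod (z j - z i))\<^sup>2)"
    by (simp add: zw prod.distrib power_mult)
  finally show ?thesis .
qed

context complex_gaussian_sequence
begin

text \<open>The first summand pays for coefficients exceeding linear growth. In the second,
  \<open>real N\<close> multiplies the logarithm of the integral of \<open>h\<close> (up to
  \<open>pi\<close>), and the subtracted sum is the logarithm of the Vandermonde lower bound divided
  by the factorials.\<close>

lemma hole_prob_upper:
  assumes r: "r > 2" and N: "N > 0" and A: "A \<ge> 2" and B: "B \<ge> 2" "4 * A * exp (2 * r\<^sup>2) < exp B"
  defines "e \<equiv> 2 * r * (r - 1) * ((r - 2) / (r - 1)) ^ N"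
  assumes e: "e \<le> 1" "e * B \<le> 1"
  shows "hole_prob M \<phi> r \<le> 4 * exp (- A\<^sup>2 / 2) +
    exp (real N * (2 * (1 + ln A) + 4 + ln B) - (\<Sum>j<N. real j * ln ((r - 2)\<^sup>2) - ln (fact j)))"
proof -
  define \<rho> where "\<rho> = r - 2"
  have \<rho>: "\<rho> > 0" using r by (simp add: \<rho>_def)
  define t where "t = 1 + ln A"
  have t: "t \<ge> 0" using A by (simp add: t_def)
  define \<alpha> where "\<alpha> = 2 - 2 / B"
  have \<alpha>: "0 \<le> \<alpha>" using B by (simp add: \<alpha>_def field_simps)
  define z where "z = (\<lambda>j. complex_of_real \<rho> * cis (2 * pi * real j / real N))"
  have z_le: "cmod (z j) \<le> r" for j using r by (simp add: z_def \<rho>_def norm_mult del: of_real_diff)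
  define a where "a = (\<lambda>n. 1 / complex_of_real (sqrt (fact n)))"
  define h where "h = (\<lambda>w::complex. if w \<noteq> 0 \<and> cmod w \<le> exp B then ennreal (exp (\<alpha> * (t - ln (cmod w)))) else 0)"
  have h[measurable]: "h \<in> borel_measurable borel" unfolding h_def by measurable
  define T where "T = (\<lambda>j (y :: nat \<Rightarrow> complex). \<Sum>n. y (n + N) * (a (n + N) * z j ^ (n + N)))"
  have T[measurable]: "T j \<in> borel_measurable (PiM {N..} (\<lambda>_. borel))" for j
    unfolding T_def by measurable
  define W where "W = (\<lambda>j \<omega>. (\<Sum>n<N. \<phi> n \<omega> * (a n * z j ^ n)) + T j (\<lambda>n\<in>{N..}. \<phi> n \<omega>))"
  have W[measurable]: "W j \<in> borel_measurable M" for j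
    unfolding W_def by measurable
  \<comment> \<open>Splitting off the first \<open>N\<close> terms is valid only where the series
    converges. Elsewhere \<open>suminf\<close> is a default value, so \<open>W\<close> replaces
    \<open>gef\<close> and agrees with it outside the exceptional event \<open>E\<close>.\<close>
  have W_eq: "W j \<omega> = gef \<phi> \<omega> (z j)" if "\<And>n. cmod (\<phi> n \<omega>) \<le> A * real (n + 1)" for j \<omega>
  proof -
    have "summable (\<lambda>n. \<phi> n \<omega> * (a n * z j ^ n))"
      using summable_gef[of \<phi> \<omega> A "z j", OF that] by (simp add: a_def)
    from suminf_split_initial_segment[OF this, of N] show ?thesis
      by (simp add: W_def T_def gef_def a_def)
  qed
  \<comment> \<open>One inequality encodes that all values are nonzero, of modulus at most
    \<open>exp B\<close>, and have mean logarithm at most \<open>t\<close>. It also makes the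
    indicator of \<open>X\<close> at most the product, which is the Chernoff step.\<close>
  define X where "X = {\<omega> \<in> space M. 1 \<le> (\<Prod>j<N. h (W j \<omega>))}"
  have X[measurable]: "X \<in> sets M" unfolding X_def by measurable
  define E where "E = {\<omega> \<in> space M. \<exists>n. cmod (\<phi> n \<omega>) > A * real (n + 1)}"
  have E[measurable]: "E \<in> sets M" unfolding E_def by measurable

  have sub: "{\<omega> \<in> space M. \<forall>z. cmod z \<le> r \<longrightarrow> gef \<phi> \<omega> z \<noteq> 0} \<subseteq> E \<union> X"
  proof (intro subsetI)
    fix \<omega> assume w: "\<omega> \<in> {\<omega> \<in> space M. \<forall>z. cmod z \<le> r \<longrightarrow> gef \<phi> \<omega> z \<noteq> 0}"
    show "\<omega> \<in> E \<union> X"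
    proof (cases "\<omega> \<in> E")
      case False
      then have c: "cmod (\<phi> n \<omega>) \<le> A * real (n + 1)" for n using w by (auto simp: E_def not_less)
      have nz: "gef \<phi> \<omega> (z j) \<noteq> 0" for j using w z_le by auto
      have le: "cmod (gef \<phi> \<omega> (z j)) \<le> exp B" for j
        using cmod_gef_le[of \<phi> \<omega> A "z j" r, OF c z_le] B by simp
      have "(\<Sum>j<N. ln (cmod (gef \<phi> \<omega> (z j)))) \<le> real N * t"
        unfolding z_def \<rho>_def t_def
        by (rule sum_ln_cmod_gef_le[of \<phi> \<omega> A r N B, OF c _ _ r N B(2) e[unfolded e_def]]) (use A w in auto)
      then have "0 \<le> (\<Sum>j<N. \<alpha> * (t - ln (cmod (gef \<phi> \<omega> (z j)))))"
        using \<alpha> by (simp add: sum_subtractf flip: sum_distrib_left)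
      then have "1 \<le> ennreal (exp (\<Sum>j<N. \<alpha> * (t - ln (cmod (gef \<phi> \<omega> (z j))))))"
        by (simp add: ennreal_ge_1)
      also have "\<dots> = (\<Prod>j<N. ennreal (exp (\<alpha> * (t - ln (cmod (gef \<phi> \<omega> (z j)))))))"
        by (simp add: exp_sum prod_ennreal)
      also have "\<dots> = (\<Prod>j<N. h (W j \<omega>))"
        by (intro prod.cong refl) (use nz le c in \<open>auto simp: h_def W_eq\<close>)
      finally show ?thesis using w by (simp add: X_def)
    qed simp
  qed

  define K where "K = exp (2 * t + 4) * B"
  have K: "K > 0" using B by (simp add: K_def)
  have inth: "(\<integral>\<^sup>+w. h w \<partial>lborel) \<le> ennreal (pi * K)"
    unfolding h_def \<alpha>_def K_def using nn_integral_norm_power_le[OF B(1) t] by simp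
  define V where "V = (\<lambda>j. \<Prod>i<j. (cmod (z j - z i))\<^sup>2)"
  have inj: "inj_on z {..<N}" unfolding z_def by (rule inj_on_scaled_roots_of_unity[OF \<rho>])
  have V: "V j > 0" if "j < N" for j
    unfolding V_def using inj that by (intro prod_pos) (auto dest!: inj_onD[OF inj])
  have "ennreal (prob X) = (\<integral>\<^sup>+\<omega>. indicator X \<omega> \<partial>M)" by (simp add: emeasure_eq_measure)
  also have "\<dots> \<le> (\<integral>\<^sup>+\<omega>. (\<Prod>j<N. h (W j \<omega>)) \<partial>M)"
    by (intro nn_integral_mono) (auto simp: X_def split: split_indicator)
  also have "\<dots> \<le> ennreal (1 / pi) ^ N * (\<Prod>j<N. ennreal (1 / ((cmod (a j))\<^sup>2 * V j)) * (\<integral>\<^sup>+w. h w \<partial>lborel))"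
    unfolding W_def V_def
    by (rule nn_integral_prod_polynomial_values_le[OF N inj, where h = "\<lambda>_. h"]) (auto simp: a_def)
  also have "\<dots> \<le> ennreal (1 / pi) ^ N * (\<Prod>j<N. ennreal (fact j / V j) * ennreal (pi * K))"
    by (intro mult_left_mono prod_mono_ennreal mult_mono inth)
       (auto simp: a_def norm_divide power_divide)
  \<comment> \<open>Distributing \<open>(1 / pi)^N\<close> over the factors lets the density bound
    cancel the \<open>pi\<close> from the integral of \<open>h\<close>.\<close>
  also have "\<dots> = (\<Prod>j<N. ennreal (1 / pi) * (ennreal (fact j / V j) * ennreal (pi * K)))"
    by (simp add: prod.distrib)
  also have "\<dots> = (\<Prod>j<N. ennreal (fact j / V j * K))"
  proof (intro prod.cong refl)
    fix j assume "j \<in> {..<N}"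
    then have "0 < V j" using V by simp
    then show "ennreal (1 / pi) * (ennreal (fact j / V j) * ennreal (pi * K)) = ennreal (fact j / V j * K)"
      using K by (simp add: field_simps flip: ennreal_mult)
  qed
  also have "\<dots> = ennreal (\<Prod>j<N. fact j / V j * K)"
    using V K by (intro prod_ennreal) (auto intro!: mult_nonneg_nonneg divide_nonneg_pos)
  also have "\<dots> \<le> ennreal (exp (real N * (2 * t + 4 + ln B) - (\<Sum>j<N. real j * ln (\<rho>\<^sup>2) - ln (fact j))))"
  proof (rule ennreal_leI)
    have "(\<Prod>j<N. fact j / V j * K) = (\<Prod>j<N. fact j) * K ^ N / (\<Prod>j<N. V j)"
      by (simp add: prod.distrib prod_dividef)
    also have "\<dots> \<le> (\<Prod>j<N. fact j) * K ^ N / (\<Prod>j<N. \<rho> ^ (2 * j))"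
    proof (rule divide_left_mono)
      show "(\<Prod>j<N. \<rho> ^ (2 * j)) \<le> (\<Prod>j<N. V j)"
        unfolding V_def z_def by (rule prod_diff_scaled_roots_of_unity_ge[OF \<rho>])
      show "0 \<le> (\<Prod>j<N. fact j) * K ^ N" using K by (intro mult_nonneg_nonneg prod_nonneg) auto
      show "0 < (\<Prod>j<N. V j) * (\<Prod>j<N. \<rho> ^ (2 * j))"
        using V \<rho> by (intro mult_pos_pos prod_pos) auto
    qed
    also have "\<dots> = (\<Prod>j<N. fact j * K / \<rho> ^ (2 * j))"
      by (simp add: prod.distrib prod_dividef)
    also have "\<dots> = (\<Prod>j<N. exp (2 * t + 4 + ln B - (real j * ln (\<rho>\<^sup>2) - ln (fact j))))"
    proof (intro prod.cong refl)
      fix j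
      have "exp (real j * ln (\<rho>\<^sup>2)) = \<rho> ^ (2 * j)"
        using \<rho> by (simp add: exp_of_nat_mult power_mult)
      then show "fact j * K / \<rho> ^ (2 * j) = exp (2 * t + 4 + ln B - (real j * ln (\<rho>\<^sup>2) - ln (fact j)))"
        using B by (simp add: K_def exp_add exp_diff)
    qed
    also have "\<dots> = exp (real N * (2 * t + 4 + ln B) - (\<Sum>j<N. real j * ln (\<rho>\<^sup>2) - ln (fact j)))"
      by (simp add: sum_subtractf flip: exp_sum)
    finally show "(\<Prod>j<N. fact j / V j * K) \<le> \<dots>" .
  qed
  finally have PX: "prob X \<le> exp (real N * (2 * t + 4 + ln B) - (\<Sum>j<N. real j * ln (\<rho>\<^sup>2) - ln (fact j)))"
    by (subst (asm) ennreal_le_iff) auto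
  have "hole_prob M \<phi> r \<le> prob (E \<union> X)"
    using r by (intro hole_prob_le sub) auto
  also have "\<dots> \<le> prob E + prob X" by (rule measure_Un_le) auto
  also have "prob E \<le> 4 * exp (- A\<^sup>2 / 2)"
    unfolding E_def by (rule prob_exceeds_linear[OF A])
  finally show ?thesis using PX by (simp add: t_def \<rho>_def)
qed

end

section \<open>Lower bound for the hole probability\<close>

context complex_gaussian_sequence
begin

text \<open>The terms of index between 0 and \<open>L\<close> contribute at most
  \<open>1 / L\<close> each and those from \<open>L\<close> on at most 1 in total, so they cannot
  cancel \<open>|\<phi> 0| \<ge> 3\<close>. The constant 26 is 25, from a unit disc around 4 inside
  radius 5, plus 1 for a tail probability of at least 1/2. The factor \<open>128 = 16^2 / 2\<close>
  comes from decay of ratio 1/16 in the tail.\<close>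

lemma hole_prob_lower:
  assumes r: "r \<ge> 1"
  defines "L \<equiv> nat \<lceil>128 * r\<^sup>2\<rceil>"
  shows "exp (- (26 + real L * (1 + 2 * ln (real L)) + (\<Sum>n=1..<L. max 0 (real n * ln (r\<^sup>2) - ln (fact n))))) \<le> hole_prob M \<phi> r"
proof -
  have "1 \<le> r\<^sup>2" using r by (simp add: one_le_power)
  moreover have L_ge: "128 * r\<^sup>2 \<le> real L" by (simp add: L_def)
  ultimately have L: "real L \<ge> 128" by linarith
  \<comment> \<open>The minimum with 1 keeps the density on the disc at least
    \<open>exp (- 1) / pi\<close> even where the constraint is not effective; division by
    \<open>L\<close> leaves room for all middle terms together.\<close>
  define \<beta> where "\<beta> = (\<lambda>n. min 1 (sqrt (fact n) / r ^ n) / real L)"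
  define S where "S = (\<lambda>n. if n = 0 then {w::complex. 3 \<le> cmod w} else if n < L then {w. cmod w \<le> \<beta> n}
    else {w. cmod w \<le> 2 * real (n + 1)})"
  have S[measurable]: "S n \<in> sets borel" for n
    by (auto simp: S_def intro!: borel_closed closed_Collect_le continuous_intros)
  define p where "p = (\<lambda>n. prob {\<omega> \<in> space M. \<phi> n \<omega> \<in> S n})"
  have p01: "0 \<le> p n" "p n \<le> 1" for n by (auto simp: p_def)
  define x where "x = (\<lambda>n. max 0 (real n * ln (r\<^sup>2) - ln (fact n)))"

  have p0: "exp (- 25) \<le> p 0"
  proof -
    have "1\<^sup>2 * exp (- (5::real)\<^sup>2) \<le> p 0"
      unfolding p_def
    proof (rule gaussian_prob_ge[where c = "4"])
      show "ball 4 1 \<subseteq> S 0"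
      proof
        fix w :: complex assume "w \<in> ball 4 1"
        then show "w \<in> S 0" using norm_triangle_ineq2[of 4 "4 - w"] by (simp add: S_def dist_norm)
      qed
      show "cmod w \<le> 5" if "w \<in> ball 4 1" for w
        using norm_triangle_ineq4[of 4 "4 - w"] that by (simp add: dist_norm)
    qed auto
    then show ?thesis by simp
  qed
  have pmid: "exp (- (1 + 2 * ln (real L) + x n)) \<le> p n" if n: "0 < n" "n < L" for n
  proof -
    have b: "0 < \<beta> n" "\<beta> n \<le> 1" using L r by (auto simp: \<beta>_def field_simps min_le_iff_disj)
    have "(\<beta> n)\<^sup>2 * exp (- 1\<^sup>2) \<le> p n"
      unfolding p_def by (rule gaussian_prob_ge[where c = 0]) (use b n in \<open>auto simp: S_def\<close>)
    moreover have "(\<beta> n)\<^sup>2 = exp (- (2 * ln (real L) + x n))"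
    proof -
      have "ln (\<beta> n) = ln (min 1 (sqrt (fact n) / r ^ n)) - ln (real L)"
        unfolding \<beta>_def using L r by (intro ln_divide_pos) auto
      moreover have "2 * ln (min 1 (sqrt (fact n) / r ^ n)) = - x n"
      proof -
        have "2 * ln (sqrt (fact n) / r ^ n) = ln (fact n) - real n * ln (r\<^sup>2)"
          using r by (simp add: ln_div ln_sqrt ln_realpow)
        moreover have "ln (min 1 (sqrt (fact n) / r ^ n)) = min 0 (ln (sqrt (fact n) / r ^ n))"
          using r by (auto simp: min_def)
        ultimately show ?thesis by (auto simp: x_def)
      qed
      ultimately have "2 * ln (\<beta> n) = - (2 * ln (real L) + x n)" by simp
      moreover have "(\<beta> n)\<^sup>2 = exp (2 * ln (\<beta> n))" using b by (simp add: exp_double)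
      ultimately show ?thesis by simp
    qed
    ultimately show ?thesis by (simp flip: exp_add add: algebra_simps)
  qed
  have pbig: "1 - 2 * exp (- 2) * exp (- 2) ^ n \<le> p n" if n: "n \<ge> L" for n
  proof -
    have n0: "n > 0" using L n by (cases n) auto
    have "prob {\<omega> \<in> space M. cmod (\<phi> n \<omega>) > 2 * real (n + 1)} \<le> 2 * exp (- (2 * real (n + 1))\<^sup>2 / 2)"
      by (rule gaussian_tail) simp
    also have "\<dots> \<le> 2 * exp (real (n + 1) * - 2)"
    proof -
      have "real (n + 1) \<le> (real (n + 1))\<^sup>2" by (rule self_le_power) auto
      then show ?thesis unfolding power_mult_distrib by simp
    qed
    also have "\<dots> = 2 * exp (- 2) * exp (- 2) ^ n"
      unfolding exp_of_nat_mult by simp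
    finally have le: "prob {\<omega> \<in> space M. cmod (\<phi> n \<omega>) > 2 * real (n + 1)} \<le> 2 * exp (- 2) * exp (- 2) ^ n" .
    have "{\<omega> \<in> space M. \<phi> n \<omega> \<in> S n} = space M - {\<omega> \<in> space M. cmod (\<phi> n \<omega>) > 2 * real (n + 1)}"
      using n n0 by (auto simp: S_def)
    then have "p n = 1 - prob {\<omega> \<in> space M. cmod (\<phi> n \<omega>) > 2 * real (n + 1)}"
      unfolding p_def by (subst prob_compl[symmetric]) auto
    with le show ?thesis by simp
  qed
  \<comment> \<open>With 1/5 the tail failures sum to at most
    \<open>(2/5) / (4/5) = 1/2\<close>.\<close>
  have small: "exp (- 2 :: real) \<le> 1 / 5"
    using exp_lower_Taylor_quadratic[of 2] by (simp add: exp_minus field_simps)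
  have ptail: "1 / 2 \<le> (\<Prod>n=L..<L + m. p n)" for m
  proof -
    have q: "0 \<le> 2 * exp (- 2) * exp (- 2 :: real) ^ n \<and> 2 * exp (- 2) * exp (- 2 :: real) ^ n \<le> 1" for n
    proof -
      have "exp (- 2 :: real) ^ n \<le> 1" by (intro power_le_one) auto
      then have "2 * exp (- 2) * exp (- 2 :: real) ^ n \<le> 2 * (1 / 5) * 1" by (intro mult_mono small) auto
      then show ?thesis by simp
    qed
    have gs: "(\<lambda>n. 2 * exp (- 2) * exp (- 2 :: real) ^ n) sums (2 * exp (- 2) * (1 / (1 - exp (- 2))))"
      using small by (intro sums_mult geometric_sums) auto
    have "(\<Sum>n=L..<L + m. 2 * exp (- 2) * exp (- 2 :: real) ^ n) \<le> 2 * exp (- 2) * (1 / (1 - exp (- 2)))"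
      using sum_le_suminf[OF sums_summable[OF gs], of "{L..<L + m}"] sums_unique[OF gs] by simp
    also have "\<dots> \<le> 1 / 2" using small by (simp add: field_simps)
    finally have "1 / 2 \<le> 1 - (\<Sum>n=L..<L + m. 2 * exp (- 2) * exp (- 2 :: real) ^ n)" by simp
    also have "\<dots> \<le> (\<Prod>n=L..<L + m. 1 - 2 * exp (- 2) * exp (- 2 :: real) ^ n)"
      by (rule one_minus_sum_le_prod) (rule q)
    also have "\<dots> \<le> (\<Prod>n=L..<L + m. p n)"
      using q pbig by (intro prod_mono) auto
    finally show ?thesis .
  qed
  define c where "c = exp (- 25) * (\<Prod>n=1..<L. exp (- (1 + 2 * ln (real L) + x n))) * (1 / 2)"
  have "c \<le> (\<Prod>n<m. p n)" for m
  proof -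
    \<comment> \<open>Bounding the product up to \<open>L + m\<close> and then dropping factors,
      which are at most 1, covers every \<open>m\<close>, including \<open>m < L\<close>.\<close>
    have "c \<le> p 0 * (\<Prod>n=1..<L. p n) * (\<Prod>n=L..<L + m. p n)"
      unfolding c_def using pmid p01
      by (intro mult_mono p0 ptail prod_mono mult_nonneg_nonneg prod_nonneg) auto
    also have "\<dots> = (\<Prod>n<L + m. p n)"
    proof -
      have "{..<L + m} = {0} \<union> {1..<L} \<union> {L..<L + m}" using L by auto
      also have "prod p \<dots> = prod p ({0} \<union> {1..<L}) * prod p {L..<L + m}"
        using L by (intro prod.union_disjoint) auto
      also have "prod p ({0} \<union> {1..<L}) = prod p {0} * prod p {1..<L}"
        by (intro prod.union_disjoint) auto
      finally show ?thesis by simp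
    qed
    also have "\<dots> = (\<Prod>n<m. p n) * (\<Prod>n=m..<L + m. p n)"
      using prod.atLeastLessThan_concat[of 0 m "L + m" p] by (simp add: atLeast0LessThan)
    also have "\<dots> \<le> (\<Prod>n<m. p n) * 1"
      using p01 by (intro mult_left_mono prod_le_1 prod_nonneg) auto
    finally show ?thesis by simp
  qed
  then have "c \<le> prob {\<omega> \<in> space M. \<forall>n. \<phi> n \<omega> \<in> S n}"
    unfolding p_def by (intro prob_all_ge S)
  also have "\<dots> \<le> hole_prob M \<phi> r"
  proof (rule hole_prob_ge)
    show "{\<omega> \<in> space M. \<forall>n. \<phi> n \<omega> \<in> S n} \<subseteq> {\<omega> \<in> space M. \<forall>z. cmod z \<le> r \<longrightarrow> gef \<phi> \<omega> z \<noteq> 0}"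
    proof safe
      fix \<omega> z assume w: "\<forall>n. \<phi> n \<omega> \<in> S n" and z: "cmod z \<le> r" and eq0: "gef \<phi> \<omega> z = 0"
      define T where "T = (\<lambda>n. \<phi> n \<omega> * z ^ n / complex_of_real (sqrt (fact n)))"
      define b where "b = (\<lambda>n. if n < L then 1 / real L else 0)"
      have cT: "cmod (T n) = cmod (\<phi> n \<omega>) * (cmod z ^ n / sqrt (fact n))" for n
        by (simp add: T_def norm_mult norm_divide norm_power)
      have T_le: "cmod (T (Suc n)) \<le> b (Suc n) + (1 / 2) ^ Suc n" for n
      proof (cases "Suc n < L")
        case True
        have "cmod (\<phi> (Suc n) \<omega>) \<le> \<beta> (Suc n)" using w[rule_format, of "Suc n"] True by (simp add: S_def)
        also have "\<dots> \<le> (sqrt (fact (Suc n)) / r ^ Suc n) / real L"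
          unfolding \<beta>_def by (intro divide_right_mono) auto
        finally have "cmod (T (Suc n)) \<le> (sqrt (fact (Suc n)) / r ^ Suc n) / real L * (r ^ Suc n / sqrt (fact (Suc n)))"
          unfolding cT using z r by (intro mult_mono divide_right_mono power_mono) auto
        also have "\<dots> = 1 / real L" using r by (simp del: power_Suc fact_Suc)
        also have "\<dots> \<le> b (Suc n) + (1 / 2) ^ Suc n" using True by (simp add: b_def)
        finally show ?thesis .
      next
        case False
        let ?m = "Suc n"
        have m: "128 * r\<^sup>2 \<le> real ?m" using L_ge False by linarith
        have "cmod (\<phi> ?m \<omega>) \<le> 2 * real (?m + 1)" using w[rule_format, of ?m] False by (simp add: S_def)
        moreover have "cmod z ^ ?m / sqrt (fact ?m) \<le> (1 / 5) ^ ?m"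
        proof -
          have "cmod z ^ ?m / sqrt (fact ?m) \<le> r ^ ?m / sqrt (fact ?m)"
            using z by (intro divide_right_mono power_mono) auto
          \<comment> \<open>For \<open>m \<ge> 128 * r^2\<close> the exponential is at most
            \<open>exp m\<close>, and \<open>e / 16 \<le> 3 / 16 < 1 / 5\<close>. The linear bound
            on the coefficient is then absorbed by \<open>(5 / 2)^m\<close>, leaving
            \<open>(1 / 2)^m\<close>.\<close>
          also have "\<dots> \<le> exp (16\<^sup>2 * r\<^sup>2 / 2) * (1 / 16) ^ ?m"
            using r by (intro power_div_sqrt_fact_le) auto
          also have "\<dots> \<le> exp (real ?m * 1) * (1 / 16) ^ ?m"
            using m by (intro mult_right_mono) auto
          also have "\<dots> = (exp 1 / 16) ^ ?m"
            unfolding exp_of_nat_mult by (simp add: power_divide del: power_Suc)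
          also have "\<dots> \<le> (1 / 5) ^ ?m"
            using exp_le by (intro power_mono) auto
          finally show ?thesis .
        qed
        ultimately have "cmod (T ?m) \<le> 2 * real (?m + 1) * (1 / 5) ^ ?m"
          unfolding cT by (intro mult_mono) auto
        also have "\<dots> \<le> (5 / 2) ^ ?m * (1 / 5) ^ ?m"
        proof (rule mult_right_mono)
          have m3: "3 \<le> ?m" using False L by linarith
          have "2 * real (k + 1) \<le> (5 / 2) ^ k" if "k \<ge> 3" for k :: nat
            using that by (induction k rule: dec_induct) (auto simp: power3_eq_cube eval_nat_numeral)
          from this[OF m3] show "2 * real (?m + 1) \<le> (5 / 2) ^ ?m" .
        qed auto
        also have "\<dots> = (1 / 2) ^ ?m" by (simp flip: power_mult_distrib)
        finally show ?thesis using False by (simp add: b_def)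
      qed
      have bs: "(\<lambda>n. b (Suc n) + (1 / 2) ^ Suc n) sums ((\<Sum>n<L - 1. 1 / real L) + 1)"
      proof (rule sums_add)
        have "(\<lambda>n. if n \<in> {..<L - 1} then 1 / real L else 0) sums (\<Sum>n<L - 1. 1 / real L)"
          by (rule sums_If_finite_set) simp
        also have "(\<lambda>n. if n \<in> {..<L - 1} then 1 / real L else 0) = (\<lambda>n. b (Suc n))"
          by (auto simp: b_def fun_eq_iff)
        finally show "(\<lambda>n. b (Suc n)) sums (\<Sum>n<L - 1. 1 / real L)" .
        show "(\<lambda>n. (1 / 2 :: real) ^ Suc n) sums 1" by (rule power_half_series)
      qed
      have sT: "summable (\<lambda>n. T (Suc n))"
        by (rule summable_comparison_test'[OF sums_summable[OF bs]]) (rule T_le)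
      have "gef \<phi> \<omega> z = T 0 + (\<Sum>n. T (Suc n))"
        using suminf_split_head[of T] sT summable_Suc_iff[of T] by (simp add: gef_def T_def)
      then have "T 0 = - (\<Sum>n. T (Suc n))" using eq0 by (simp add: add_eq_0_iff2)
      then have "cmod (\<phi> 0 \<omega>) = cmod (\<Sum>n. T (Suc n))" by (simp add: T_def)
      also have "\<dots> \<le> (\<Sum>n<L - 1. 1 / real L) + 1"
        using norm_suminf_le[OF T_le sums_summable[OF bs]] sums_unique[OF bs] by simp
      also have "\<dots> \<le> 2" using L by simp
      finally show False using w[rule_format, of 0] by (simp add: S_def)
    qed
  qed (use r in auto)
  finally have "c \<le> hole_prob M \<phi> r" .
  moreover have "exp (- (26 + real L * (1 + 2 * ln (real L)) + (\<Sum>n=1..<L. x n))) \<le> c"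
  proof -
    have "exp (- 1 :: real) \<le> 1 / 2" using exp_ge_add_one_self[of 1] by (simp add: exp_minus field_simps)
    have "(\<Sum>n=1..<L. 1 + 2 * ln (real L)) \<le> real L * (1 + 2 * ln (real L))"
      using L by (simp add: mult_right_mono)
    then have "- (26 + real L * (1 + 2 * ln (real L)) + (\<Sum>n=1..<L. x n)) \<le> - 25 + (\<Sum>n=1..<L. - (1 + 2 * ln (real L) + x n)) + - 1"
    proof -
      have "(\<Sum>n=1..<L. - (d + x n)) = - ((\<Sum>n=1..<L. d) + (\<Sum>n=1..<L. x n))" for d
        by (simp only: sum_negf sum.distrib)
      from this[of "1 + 2 * ln (real L)"] show ?thesis
        using \<open>(\<Sum>n=1..<L. 1 + 2 * ln (real L)) \<le> _\<close> by linarith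
    qed
    then have "exp (- (26 + real L * (1 + 2 * ln (real L)) + (\<Sum>n=1..<L. x n))) \<le> exp (- 25) * exp (\<Sum>n=1..<L. - (1 + 2 * ln (real L) + x n)) * exp (- 1)"
      by (simp flip: exp_add)
    also have "\<dots> \<le> c"
      unfolding c_def by (intro mult_mono \<open>exp (- 1 :: real) \<le> 1 / 2\<close>) (auto simp: exp_sum intro!: mult_nonneg_nonneg prod_nonneg)
    finally show ?thesis .
  qed
  ultimately show ?thesis by (simp add: x_def)
qed

end

section \<open>Asymptotics\<close>

context complex_gaussian_sequence
begin

text \<open>Positivity is recorded along with the estimate because of \<open>ln 0 = 0\<close>; the
  converse estimate relies on it when taking logarithms.\<close>

lemma eventually_neg_log_hole_prob_le:
  "eventually (\<lambda>r. 0 < hole_prob M \<phi> r \<and> neg_log_hole_prob M \<phi> r \<le> (exp 1)\<^sup>2 / 4 * r ^ 4 + r powr (18 / 5)) at_top"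
proof -
  have "eventually (\<lambda>r::real. 26 + (128 * r\<^sup>2 + 1) * (1 + 2 * ln (128 * r\<^sup>2 + 1)) + 2 * exp 1 * r\<^sup>2 \<le> r powr (18 / 5)) at_top"
    by real_asymp
  moreover have "eventually (\<lambda>r::real. r \<ge> 1) at_top" by (rule eventually_ge_at_top)
  ultimately show ?thesis
  proof eventually_elim
    case (elim r)
    define L where "L = nat \<lceil>128 * r\<^sup>2\<rceil>"
    define S where "S = (\<Sum>n=1..<L. max 0 (real n * ln (r\<^sup>2) - ln (fact n)))"
    have r1: "1 \<le> r\<^sup>2" using elim by (simp add: one_le_power)
    have L: "1 \<le> real L" "real L \<le> 128 * r\<^sup>2 + 1"
      using r1 unfolding L_def by linarith+
    have low: "exp (- (26 + real L * (1 + 2 * ln (real L)) + S)) \<le> hole_prob M \<phi> r"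
      unfolding S_def L_def using elim by (intro hole_prob_lower) auto
    then have pos: "0 < hole_prob M \<phi> r" by (rule less_le_trans[rotated]) simp
    have "- (26 + real L * (1 + 2 * ln (real L)) + S) \<le> ln (hole_prob M \<phi> r)"
      using low pos by (subst ln_ge_iff) auto
    then have "neg_log_hole_prob M \<phi> r \<le> 26 + real L * (1 + 2 * ln (real L)) + S"
      by (simp add: neg_log_hole_prob_def)
    also have "real L * (1 + 2 * ln (real L)) \<le> (128 * r\<^sup>2 + 1) * (1 + 2 * ln (128 * r\<^sup>2 + 1))"
      using L by (intro mult_mono add_mono mult_left_mono ln_mono) auto
    also have "S \<le> (exp 1)\<^sup>2 / 4 * (r\<^sup>2)\<^sup>2 + 2 * exp 1 * r\<^sup>2"
      unfolding S_def by (rule sum_max_ln_power_div_fact_le[OF r1])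
    also have "(r\<^sup>2)\<^sup>2 = r ^ 4" by simp
    finally have "neg_log_hole_prob M \<phi> r \<le> (exp 1)\<^sup>2 / 4 * r ^ 4 + r powr (18 / 5)"
      using elim by simp
    with pos show ?case by simp
  qed
qed

lemma eventually_neg_log_hole_prob_ge:
  "eventually (\<lambda>r. (exp 1)\<^sup>2 / 4 * r ^ 4 - r powr (18 / 5) \<le> neg_log_hole_prob M \<phi> r) at_top"
proof -
  \<comment> \<open>\<open>Q\<close> collects the \<open>O(r^2 ln r)\<close> errors: the disc
    integrals with \<open>A = 2 * r^2\<close> and \<open>B = 10 * r^2\<close>, and the Stirling
    errors, both for \<open>N \<le> 3 * r^2\<close>.\<close>
  define Q where "Q = (\<lambda>r::real. 3 * r\<^sup>2 * (2 * (1 + ln (2 * r\<^sup>2)) + 4 + ln (10 * r\<^sup>2))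
    + 2 + ln r + 3 * r\<^sup>2 * (5 / 4 + ln r + ln (3 * r\<^sup>2)))"
  have "eventually (\<lambda>r::real. r \<ge> 8) at_top" by (rule eventually_ge_at_top)
  moreover have "eventually (\<lambda>r::real. 20 * r ^ 4 * exp (- r) \<le> 1) at_top" by real_asymp
  moreover have "eventually (\<lambda>r::real. 4 * (2 * r\<^sup>2) * exp (2 * r\<^sup>2) < exp (10 * r\<^sup>2)) at_top" by real_asymp
  moreover have "eventually (\<lambda>r::real. Q r + (exp 1)\<^sup>2 / 4 * (r ^ 4 - (r - 2) ^ 4) + ln 2 \<le> r powr (18 / 5)) at_top"
    unfolding Q_def by real_asymp
  moreover have "eventually (\<lambda>r::real. (exp 1)\<^sup>2 / 4 * r ^ 4 - r powr (18 / 5) + ln 8 \<le> 2 * r ^ 4) at_top"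
  proof -
    \<comment> \<open>The choice \<open>A = 2 * r^2\<close> makes the exceptional probability at
      most \<open>4 * exp (- 2 * r^4)\<close>, negligible since
      \<open>e^2 / 4 \<le> 1.85 < 2\<close>. The term \<open>ln 8\<close> accounts for the factor 4
      and for allotting half of the final bound to this event.\<close>
    have "(exp 1 :: real)\<^sup>2 \<le> (272 / 100)\<^sup>2" using e_less_272 by (intro power_mono) auto
    then have "(exp 1 :: real)\<^sup>2 / 4 \<le> 37 / 20" by (simp add: power2_eq_square)
    then have le: "(exp 1)\<^sup>2 / 4 * r ^ 4 \<le> 37 / 20 * r ^ 4" for r :: real
      by (intro mult_right_mono) auto
    have "eventually (\<lambda>r::real. 37 / 20 * r ^ 4 - r powr (18 / 5) + ln 8 \<le> 2 * r ^ 4) at_top" by real_asymp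
    then show ?thesis
    proof eventually_elim
      case (elim r)
      then show ?case using le[of r] by linarith
    qed
  qed
  moreover note eventually_neg_log_hole_prob_le
  ultimately show ?thesis
  proof eventually_elim
    case (elim r)
    define x where "x = (r - 2)\<^sup>2"
    define N where "N = nat \<lfloor>exp 1 * x\<rfloor>"
    define A where "A = 2 * r\<^sup>2"
    define B where "B = 10 * r\<^sup>2"
    have r: "r \<ge> 8" by fact
    have r2: "64 \<le> r\<^sup>2" using power_mono[OF r, of 2] by simp
    have x36: "36 \<le> x" using power_mono[of 6 "r - 2" 2] r by (simp add: x_def)
    have xr: "x \<le> r\<^sup>2" unfolding x_def using r by (intro power_mono) auto
    have e2: "2 \<le> (exp 1 :: real)" using exp_ge_add_one_self[of 1] by simp
    have e3: "(exp 1 :: real) \<le> 3" by (rule exp_le)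
    have N: "real N \<le> exp 1 * x" "exp 1 * x - 1 \<le> real N"
      using x36 by (auto simp: N_def)
    have "2 * x \<le> exp 1 * x" using e2 x36 by (intro mult_right_mono) auto
    with N have N_ge: "2 * x - 1 \<le> real N" by linarith
    then have N0: "N > 0" using x36 by linarith
    have "exp 1 * x \<le> 3 * r\<^sup>2" using e3 xr x36 by (intro mult_mono) auto
    with N have N_le: "real N \<le> 3 * r\<^sup>2" by linarith

    define e where "e = 2 * r * (r - 1) * ((r - 2) / (r - 1)) ^ N"
    have "((r - 2) / (r - 1)) ^ N \<le> exp (- r)"
    proof -
      have "(r - 2) / (r - 1) = 1 + (- 1 / (r - 1))" using r by (simp add: field_simps)
      also have "\<dots> \<le> exp (- 1 / (r - 1))" by (rule exp_ge_add_one_self)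
      finally have "((r - 2) / (r - 1)) ^ N \<le> exp (- 1 / (r - 1)) ^ N"
        using r by (intro power_mono) auto
      also have "\<dots> = exp (real N * (- 1 / (r - 1)))" by (rule exp_of_nat_mult[symmetric])
      also have "\<dots> \<le> exp (- r)"
      proof -
        \<comment> \<open>The difference \<open>2 * x - 1 - r * (r - 1) = r^2 - 7 * r + 7\<close>
          exceeds this product by 15. It yields \<open>N \<ge> r * (r - 1)\<close>, which turns
          \<open>(1 - 1 / (r - 1))^N\<close> into \<open>exp (- r)\<close>.\<close>
        have "(r - 8) * (r + 1) \<ge> 0" using r by (intro mult_nonneg_nonneg) auto
        then have "r * (r - 1) \<le> 2 * x - 1" by (simp add: x_def power2_eq_square algebra_simps)
        then have "r * (r - 1) \<le> real N" using N_ge by linarith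
        then show ?thesis using r by (simp add: field_simps)
      qed
      finally show ?thesis .
    qed
    then have "e \<le> 2 * r * (r - 1) * exp (- r)"
      unfolding e_def using r by (intro mult_left_mono) auto
    also have "\<dots> \<le> 2 * r * r * exp (- r)" using r by (intro mult_right_mono mult_left_mono) auto
    finally have "e * B \<le> 2 * r * r * exp (- r) * B"
      using r2 by (intro mult_right_mono) (auto simp: B_def)
    also have "\<dots> = 20 * r ^ 4 * exp (- r)" by (simp add: B_def eval_nat_numeral)
    also have "\<dots> \<le> 1" by fact
    finally have eB: "e * B \<le> 1" .
    have e0: "0 \<le> e" unfolding e_def using r by auto
    have "e * 1 \<le> e * B" using e0 r2 by (intro mult_left_mono) (auto simp: B_def)
    with eB have e1: "e \<le> 1" by simp

    define S where "S = (\<Sum>j<N. real j * ln x - ln (fact j))"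
    have up: "hole_prob M \<phi> r \<le> 4 * exp (- A\<^sup>2 / 2) + exp (real N * (2 * (1 + ln A) + 4 + ln B) - S)"
      unfolding S_def x_def
      by (rule hole_prob_upper) (use r N0 r2 elim e1 eB in \<open>auto simp: A_def B_def e_def\<close>)
    have S: "(exp 1)\<^sup>2 / 4 * x\<^sup>2 - 2 - ln x / 2 - real N * (5 / 4 + ln x / 2 + ln (real N)) \<le> S"
      unfolding S_def using x36 N N0 by (intro sum_ln_power_div_fact_ge) auto
    have lnx: "ln x / 2 \<le> ln r" "0 \<le> ln x"
    proof -
      have "ln x \<le> ln (r\<^sup>2)" using xr x36 by (intro ln_mono) auto
      then show "ln x / 2 \<le> ln r" using r by (simp add: ln_realpow)
    qed (use x36 in auto)
    have lnN: "0 \<le> ln (real N)" "ln (real N) \<le> ln (3 * r\<^sup>2)" using N0 N_le by (auto intro!: ln_mono)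
    have "real N * (5 / 4 + ln x / 2 + ln (real N)) \<le> 3 * r\<^sup>2 * (5 / 4 + ln r + ln (3 * r\<^sup>2))"
      using N_le lnx lnN by (intro mult_mono add_mono) auto
    moreover have "real N * (2 * (1 + ln A) + 4 + ln B) \<le> 3 * r\<^sup>2 * (2 * (1 + ln (2 * r\<^sup>2)) + 4 + ln (10 * r\<^sup>2))"
      unfolding A_def B_def using N_le r2 by (intro mult_right_mono) auto
    ultimately have "real N * (2 * (1 + ln A) + 4 + ln B) - S \<le> Q r - (exp 1)\<^sup>2 / 4 * x\<^sup>2"
      using S lnx unfolding Q_def by linarith
    also have "x\<^sup>2 = (r - 2) ^ 4" by (simp add: x_def)
    also have "Q r - (exp 1)\<^sup>2 / 4 * (r - 2) ^ 4 \<le> - ((exp 1)\<^sup>2 / 4 * r ^ 4 - r powr (18 / 5)) - ln 2"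
      using elim(4) by (simp add: algebra_simps)
    finally have "exp (real N * (2 * (1 + ln A) + 4 + ln B) - S) \<le> exp (- ((exp 1)\<^sup>2 / 4 * r ^ 4 - r powr (18 / 5)) - ln 2)"
      by simp
    also have "\<dots> = exp (- ((exp 1)\<^sup>2 / 4 * r ^ 4 - r powr (18 / 5))) / 2" by (simp add: exp_diff)
    finally have b1: "exp (real N * (2 * (1 + ln A) + 4 + ln B) - S) \<le> exp (- ((exp 1)\<^sup>2 / 4 * r ^ 4 - r powr (18 / 5))) / 2" .
    have "4 * exp (- A\<^sup>2 / 2) = exp (ln 8 - 2 * r ^ 4) / 2"
      by (simp add: A_def exp_diff exp_minus field_simps)
    also have "\<dots> \<le> exp (- ((exp 1)\<^sup>2 / 4 * r ^ 4 - r powr (18 / 5))) / 2"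
      using elim(5) by simp
    finally have "hole_prob M \<phi> r \<le> exp (- ((exp 1)\<^sup>2 / 4 * r ^ 4 - r powr (18 / 5)))"
      using up b1 by linarith
    moreover have "0 < hole_prob M \<phi> r" using elim by simp
    ultimately have "ln (hole_prob M \<phi> r) \<le> - ((exp 1)\<^sup>2 / 4 * r ^ 4 - r powr (18 / 5))"
      by (metis ln_exp ln_mono)
    then show ?case by (simp add: neg_log_hole_prob_def)
  qed
qed

end

theorem theorem1:
  fixes M :: "'a measure" and \<phi> :: "nat \<Rightarrow> 'a \<Rightarrow> complex"
  assumes "prob_space M"
    and "iid_std_complex_gaussian M \<phi>"
  shows "\<exists>C r0 :: real. C > 0 \<and> r0 > 0 \<and>
    (\<forall>r\<ge>r0. \<bar>neg_log_hole_prob M \<phi> r - (exp 1)\<^sup>2 / 4 * r ^ 4\<bar> \<le> C * r powr (18 / 5))"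
proof -
  interpret complex_gaussian_sequence M \<phi>
    by (intro complex_gaussian_sequence.intro complex_gaussian_sequence_axioms.intro assms)
  have "eventually (\<lambda>r. \<bar>neg_log_hole_prob M \<phi> r - (exp 1)\<^sup>2 / 4 * r ^ 4\<bar> \<le> r powr (18 / 5)) at_top"
    using eventually_neg_log_hole_prob_le eventually_neg_log_hole_prob_ge
    by eventually_elim linarith
  then obtain r0 where "\<forall>r\<ge>r0. \<bar>neg_log_hole_prob M \<phi> r - (exp 1)\<^sup>2 / 4 * r ^ 4\<bar> \<le> r powr (18 / 5)"
    by (auto simp: eventually_at_top_linorder)
  then show ?thesis by (intro exI[of _ 1] exI[of _ "max r0 1"]) auto
qed

end
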